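(* Let $G$ be a finitely generated group with finitely generated subgroups $H_1,\ldots,H_n$. For $i=1,\ldots,n$, let $X_i$ be a nontrivial $H_i$-almost invariant subset of $G$, and let $E=\{gX_i,gX_i^{\ast}: g\in G, 1\leq i\leq n\}$. Suppose that the $X_i$'s are in good position. Let $(E,\subset)$ denote the set $E$ with the partial order given by inclusion, and let $(E,\leq)$ denote the set $E$ with the partial order given by almost inclusion. Let $C$ denote the cubing constructed from the poset $(E,\subset)$ and let $L$ denote the cubing constructed from the poset $(E,\leq)$ (both constructions are described in the context). Then there is a natural $G$-equivariant embedding $L\rightarrow C$.
   Context: Almost invariant sets. For a subgroup $H$ of $G$, $H\backslash G$ is the set of cosets $Hg$, on which $G$ acts on the right. Two sets are almost equal if their symmetric difference is finite. A subset $P$ of a set with right $G$-action is almost invariant if $Pg$ is almost equal to $P$ for all $g\in G$. A subset $X\subset G$ is $H$-almost invariant if $hX=X$ for all $h\in H$ and $H\backslash X$ is an almost invariant subset of $H\backslash G$; it is nontrivial if $H\backslash X$ and $H\backslash X^{\ast}$ are both infinite, where $X^{\ast}=G-X$. A subset of $G$ is $H$-finite if it is contained in a finite union of cosets $Hg$. If $X$ is $H$-almost invariant then $gX$ is $gHg^{-1}$-almost invariant. Good position and the order $\leq$. The corners of a pair $(U,V)$ of subsets of $G$ are $U\cap V$, $U^{\ast}\cap V$, $U\cap V^{\ast}$, $U^{\ast}\cap V^{\ast}$. If $U$ is a nontrivial $H$-almost invariant set and $V$ is a nontrivial $K$-almost invariant set, a corner of $(U,V)$ is small if it is $H$-finite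 (equivalently $K$-finite). The $X_i$'s are in good position if, whenever $U,V\in E$ and two of the four corners of $(U,V)$ are small, one of the four corners is empty. In that case the relation of almost inclusion on $E$, defined by $U\leq V$ if and only if $U\cap V^{\ast}$ is empty or is the only small set among the four corners of $(U,V)$, is a partial order. Ultrafilters. Let $E$ be a partially ordered set with an involution $A\mapsto A^{\ast}$ such that $A\neq A^{\ast}$ and such that $A\leq B$ implies $B^{\ast}\leq A^{\ast}$. An ultrafilter on $E$ is a subset $V\subset E$ such that (1) for every $A\in E$, exactly one of $A\in V$, $A^{\ast}\in V$ holds; (2) if $A\in V$, $B\in E$ and $A\leq B$ then $B\in V$. The cubed complex of such a poset. Its vertices are the ultrafilters on $E$. Two vertices $V,V'$ are joined by an edge if and only if $V'=(V-\{A\})\cup\{A^{\ast}\}$ for some $A\in V$. Inductively, for $n\geq 2$, one $n$-cube is attached to the $(n-1)$-skeleton for each occurrence in it of the boundary of an $n$-cube, by an isomorphism of boundaries. The action of $G$ on $E$ by left translation induces an action of $G$ on the complex. The cubing $C$. Let $K$ be the cubed complex of $(E,\subset)$ with involution $A\mapsto A^{\ast}$. For $g\in G$ let $V_g=\{A\in E: g\in A\}$, an ultrafilter on $(E,\subset)$, called a basic vertex of $K$. All basic vertices lie in a single component, $C$, of $K$; it is $G$-invariant and is a cubing (a simply connected $CAT(0)$ cubed complex). The cubing $L$. Let $\Lambda$ be the cubed complex of $(E,\leq)$ with involution $A\mapsto A^{\ast}$. Let $\Gamma$ be the Cayley graph of $G$ for a finite generating set, let $N_R(g)$ be the ball of radius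 $R$ about $g$ in $\Gamma$, and let $\delta A$ be the set of edges of $\Gamma$ with exactly one endpoint in $A$. Fix $R>0$ such that whenever $A,B\in E$, $A\leq B$, $g\in A$ and $N_R(g)\subset A$, one has $g\in B$ (such an $R$ exists). For $g\in G$, let $E_R=\{A\in E:\delta A\cap N_R(g)\neq\emptyset\}$ (a finite set), $E_R^{\ast}=E-E_R$, $U_g=\{A\in E_R^{\ast}: g\in A\}$, and $U_1=U_g\cup\{B\in E_R:\exists A\in U_g, A\leq B\}$. Inductively, for a set $S\subset E$ write $S^{\ast}=\{A^{\ast}:A\in S\}$; if $V_k:=E-(U_k\cup U_k^{\ast})$ is non-empty, choose a minimal element $A_k$ of $V_k$ and let $U_{k+1}=U_k\cup\{B\in V_k: A_k\leq B\}$. This process ends after finitely many steps with an ultrafilter $W_g$ on $(E,\leq)$; any $W_g$ obtained in this way (for any $g$ and any choices of minimal elements) is called a basic vertex of $\Lambda$. All basic vertices of $\Lambda$ lie in a single component $L$ of $\Lambda$, which is $G$-invariant and is a cubing. An embedding of cubed complexes is an injective map taking each cube isometrically onto a cube; "natural" means that on vertices the map regards a vertex of $L$, which is a subset of $E$, as a vertex of $C$, which is again a subset of $E$. *)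

theory Defs
  imports "HOL-Algebra.Generated_Groups" "HOL-Analysis.L2_Norm" "HOL-Library.FSet"
begin

section \<open>Almost invariant sets\<close>

definition finitely_generated_subgroup :: "('a, 'b) monoid_scheme \<Rightarrow> 'a set \<Rightarrow> bool" where
  "finitely_generated_subgroup G K \<longleftrightarrow>
     subgroup K G \<and> (\<exists>T. finite T \<and> T \<subseteq> carrier G \<and> generate G T = K)"

definition almost_equal :: "'c set \<Rightarrow> 'c set \<Rightarrow> bool" where
  "almost_equal P Q \<longleftrightarrow> finite ((P - Q) \<union> (Q - P))"

definition almost_invariant :: "('a, 'b) monoid_scheme \<Rightarrow> ('c \<Rightarrow> 'a \<Rightarrow> 'c) \<Rightarrow> 'c set \<Rightarrow> bool" where
  "almost_invariant G act P \<longleftrightarrow> (\<forall>g\<in>carrier G. almost_equal ((\<lambda>p. act p g) ` P) P)"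

text \<open>The image of \<open>Y\<close> in the set of cosets \<open>Hg\<close>.\<close>
definition left_quotient :: "('a, 'b) monoid_scheme \<Rightarrow> 'a set \<Rightarrow> 'a set \<Rightarrow> 'a set set" where
  "left_quotient G H Y = (\<lambda>y. H #>\<^bsub>G\<^esub> y) ` Y"

definition almost_invariant_over :: "('a, 'b) monoid_scheme \<Rightarrow> 'a set \<Rightarrow> 'a set \<Rightarrow> bool" where
  "almost_invariant_over G H Y \<longleftrightarrow>
     Y \<subseteq> carrier G \<and> (\<forall>h\<in>H. h <#\<^bsub>G\<^esub> Y = Y) \<and>
     almost_invariant G (\<lambda>P g. P #>\<^bsub>G\<^esub> g) (left_quotient G H Y)"

definition nontrivial_almost_invariant :: "('a, 'b) monoid_scheme \<Rightarrow> 'a set \<Rightarrow> 'a set \<Rightarrow> bool" where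
  "nontrivial_almost_invariant G H Y \<longleftrightarrow>
     almost_invariant_over G H Y \<and>
     infinite (left_quotient G H Y) \<and> infinite (left_quotient G H (carrier G - Y))"

definition subgroup_finite :: "('a, 'b) monoid_scheme \<Rightarrow> 'a set \<Rightarrow> 'a set \<Rightarrow> bool" where
  "subgroup_finite G H Y \<longleftrightarrow>
     (\<exists>F. finite F \<and> F \<subseteq> carrier G \<and> Y \<subseteq> (\<Union>g\<in>F. H #>\<^bsub>G\<^esub> g))"

definition translates :: "('a, 'b) monoid_scheme \<Rightarrow> nat \<Rightarrow> (nat \<Rightarrow> 'a set) \<Rightarrow> 'a set set" where
  "translates G n X =
     {g <#\<^bsub>G\<^esub> X i | g i. g \<in> carrier G \<and> i \<in> {1..n}} \<union>
     {g <#\<^bsub>G\<^esub> (carrier G - X i) | g i. g \<in> carrier G \<and> i \<in> {1..n}}"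


section \<open>Good position and almost inclusion\<close>

definition corner :: "('a, 'b) monoid_scheme \<Rightarrow> bool \<times> bool \<Rightarrow> 'a set \<Rightarrow> 'a set \<Rightarrow> 'a set" where
  "corner G p U V =
     (if fst p then U else carrier G - U) \<inter> (if snd p then V else carrier G - V)"

text \<open>
  A corner of \<open>(U, V)\<close> is small if it is finite over a group for which \<open>U\<close> is nontrivial almost
  invariant. For a member \<open>g X\<^sub>i\<close> or \<open>g X\<^sub>i\<^sup>*\<close> of \<open>translates G n X\<close> that group is \<open>g H\<^sub>i g\<inverse>\<close>. The
  existential quantifier is over the ways of writing \<open>U\<close> in this form; they all give the same notion.
\<close>
definition small_corner ::
  "('a, 'b) monoid_scheme \<Rightarrow> nat \<Rightarrow> (nat \<Rightarrow> 'a set) \<Rightarrow> (nat \<Rightarrow> 'a set) \<Rightarrow>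
   bool \<times> bool \<Rightarrow> 'a set \<Rightarrow> 'a set \<Rightarrow> bool" where
  "small_corner G n H X p U V \<longleftrightarrow>
     (\<exists>i\<in>{1..n}. \<exists>g\<in>carrier G.
        (U = g <#\<^bsub>G\<^esub> X i \<or> U = g <#\<^bsub>G\<^esub> (carrier G - X i)) \<and>
        subgroup_finite G ((g <#\<^bsub>G\<^esub> H i) #>\<^bsub>G\<^esub> inv\<^bsub>G\<^esub> g) (corner G p U V))"

definition good_position ::
  "('a, 'b) monoid_scheme \<Rightarrow> nat \<Rightarrow> (nat \<Rightarrow> 'a set) \<Rightarrow> (nat \<Rightarrow> 'a set) \<Rightarrow> bool" where
  "good_position G n H X \<longleftrightarrow>
     (\<forall>U\<in>translates G n X. \<forall>V\<in>translates G n X.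
        (\<exists>p q. p \<noteq> q \<and> small_corner G n H X p U V \<and> small_corner G n H X q U V) \<longrightarrow>
        (\<exists>p. corner G p U V = {}))"

text \<open>\<open>(True, False)\<close> is the corner \<open>U \<inter> V\<^sup>*\<close>.\<close>
definition almost_incl ::
  "('a, 'b) monoid_scheme \<Rightarrow> nat \<Rightarrow> (nat \<Rightarrow> 'a set) \<Rightarrow> (nat \<Rightarrow> 'a set) \<Rightarrow> 'a set \<Rightarrow> 'a set \<Rightarrow> bool" where
  "almost_incl G n H X U V \<longleftrightarrow>
     corner G (True, False) U V = {} \<or>
     (\<forall>p. small_corner G n H X p U V \<longleftrightarrow> p = (True, False))"


section \<open>Cubed complexes\<close>

text \<open>
  A cell is a vertex, or a cube attached along its boundary and recorded by the finite set of its
  codimension-one faces. Hence two cubes of positive dimension are equal iff they have the same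
  boundary, and an isomorphism between boundaries of cubes is determined by its effect on the
  vertices, where it acts through \<^term>\<open>map_cell\<close>.
\<close>
datatype 'v cell = Vert 'v | Cube "'v cell fset"

definition coords :: "nat \<Rightarrow> nat fset" where
  "coords n = fset_of_list [0..<n]"

text \<open>
  A vertex of \<open>[0,1]\<^sup>n\<close> is represented by the set of those coordinates that equal 1.
  \<open>std_face A B\<close>, for \<open>A \<subseteq> B\<close>, is the face consisting of the points whose coordinates
  are 1 on \<open>A\<close> and 0 off \<open>B\<close>; the coordinates in \<open>B - A\<close> are free.
\<close>
function std_face :: "nat fset \<Rightarrow> nat fset \<Rightarrow> nat fset cell" where
  "std_face A B =
     (if B |\<subseteq>| A then Vert A
      else Cube ((\<lambda>i. std_face (finsert i A) B) |`| (B |-| A) |\<union>|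
                 (\<lambda>i. std_face A (B |-| {|i|})) |`| (B |-| A)))"
  by pat_completeness auto
termination
proof (relation "measure (\<lambda>(A, B). fcard (B |-| A))", goal_cases)
  case 1
  show ?case by simp
next
  case (2 A B i)
  then have "B |-| finsert i A |\<subset>| B |-| A" by auto
  then show ?case by (simp add: pfsubset_fcard_mono)
next
  case (3 A B i)
  then have "(B |-| {|i|}) |-| A |\<subset>| B |-| A" by auto
  then show ?case by (simp add: pfsubset_fcard_mono)
qed

declare std_face.simps [simp del]

definition std_cube :: "nat \<Rightarrow> nat fset cell" where
  "std_cube n = std_face {||} (coords n)"

definition std_facets :: "nat \<Rightarrow> nat fset cell set" where
  "std_facets n =
     (\<lambda>i. std_face {|i|} (coords n)) ` {..<n} \<union>
     (\<lambda>i. std_face {||} (coords n |-| {|i|})) ` {..<n}"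

definition std_vertices :: "nat \<Rightarrow> nat fset set" where
  "std_vertices n = {e. e |\<subseteq>| coords n}"

text \<open>
  \<open>n_cube Vs adj n c\<close>: \<open>c\<close> is an \<open>n\<close>-cube of the cubed complex with 1-skeleton the graph
  \<open>(Vs, adj)\<close>. In the last rule, \<open>\<phi>\<close> describes an occurrence of the boundary of \<open>[0,1]\<^sup>n\<close> in the
  \<open>(n-1)\<close>-skeleton, and \<open>map_cell \<phi> (std_cube n)\<close> is the cube attached there; different
  \<open>\<phi>\<close> with the same image subcomplex yield the same cube.
\<close>
inductive n_cube :: "'v set \<Rightarrow> ('v \<Rightarrow> 'v \<Rightarrow> bool) \<Rightarrow> nat \<Rightarrow> 'v cell \<Rightarrow> bool"
  for Vs :: "'v set" and adj :: "'v \<Rightarrow> 'v \<Rightarrow> bool" where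
  vertex: "v \<in> Vs \<Longrightarrow> n_cube Vs adj 0 (Vert v)"
| edge: "v \<in> Vs \<Longrightarrow> w \<in> Vs \<Longrightarrow> adj v w \<Longrightarrow> n_cube Vs adj 1 (Cube {|Vert v, Vert w|})"
| cube: "2 \<le> n \<Longrightarrow> inj_on \<phi> (std_vertices n) \<Longrightarrow>
    (\<And>F. F \<in> std_facets n \<Longrightarrow> n_cube Vs adj (n - 1) (map_cell \<phi> F)) \<Longrightarrow>
    n_cube Vs adj n (map_cell \<phi> (std_cube n))"

definition cubed_complex :: "'v set \<Rightarrow> ('v \<Rightarrow> 'v \<Rightarrow> bool) \<Rightarrow> 'v cell set" where
  "cubed_complex Vs adj = {c. \<exists>n. n_cube Vs adj n c}"

definition edge_joined :: "'v cell set \<Rightarrow> 'v \<Rightarrow> 'v \<Rightarrow> bool" where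
  "edge_joined K v w \<longleftrightarrow> Vert v \<in> K \<and> Vert w \<in> K \<and> Cube {|Vert v, Vert w|} \<in> K"

text \<open>
  The part of \<open>K\<close> joined by edge paths to a vertex of \<open>K\<close> lying in \<open>B\<close>. If the vertices in \<open>B\<close>
  lie in a single component of \<open>K\<close> (and there is at least one), it is that component.
\<close>
definition component_containing :: "'v cell set \<Rightarrow> 'v set \<Rightarrow> 'v cell set" where
  "component_containing K B =
     {c \<in> K. \<forall>v\<in>set_cell c. \<exists>b\<in>B. Vert b \<in> K \<and> (edge_joined K)\<^sup>*\<^sup>* b v}"


section \<open>Geometric realization\<close>

definition unit_cube :: "nat \<Rightarrow> (nat \<Rightarrow> real) set" where
  "unit_cube n = {..<n} \<rightarrow>\<^sub>E {0..1}"

text \<open>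
  A point of the realization is the pair of the unique cell having it in its interior and its
  weights on the vertices. The weight of \<open>x \<in> [0,1]\<^sup>n\<close> at a vertex \<open>e\<close> of \<open>[0,1]\<^sup>n\<close> is the product
  of the \<open>x\<^sub>i\<close> with \<open>e\<^sub>i = 1\<close> and of the \<open>1 - x\<^sub>i\<close> with \<open>e\<^sub>i = 0\<close>. These weights determine \<open>x\<close>,
  vanish off the smallest face containing \<open>x\<close>, restrict to the weights of that face, and are
  transported by the symmetries of the cube. So this represents the quotient of the disjoint union
  of the cubes by the attaching maps, with no choice of coordinates on the cells.
\<close>
type_synonym 'v point = "'v cell \<times> ('v \<Rightarrow> real)"

definition std_point :: "nat \<Rightarrow> (nat \<Rightarrow> real) \<Rightarrow> nat fset point" where
  "std_point n x =
     (std_face (ffilter (\<lambda>i. x i = 1) (coords n)) (ffilter (\<lambda>i. x i \<noteq> 0) (coords n)),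
      \<lambda>e. if e \<in> std_vertices n
          then (\<Prod>i | i < n \<and> i |\<in>| e. x i) * (\<Prod>i | i < n \<and> i |\<notin>| e. 1 - x i) else 0)"

text \<open>The effect on points of a map of vertices; weights are pushed forward.\<close>
definition map_point :: "('u \<Rightarrow> 'v) \<Rightarrow> 'u point \<Rightarrow> 'v point" where
  "map_point h p =
     (map_cell h (fst p), \<lambda>v. \<Sum>u | snd p u \<noteq> 0 \<and> h u = v. snd p u)"

definition vertex_point :: "'v \<Rightarrow> 'v point" where
  "vertex_point v = (Vert v, \<lambda>w. if w = v then 1 else 0)"

text \<open>\<open>\<phi>\<close> is a parametrization of the cell \<open>c\<close> by \<open>[0,1]\<^sup>n\<close>, with characteristic map
  \<open>\<lambda>x. map_point \<phi> (std_point n x)\<close>.\<close>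
definition chart :: "nat \<Rightarrow> (nat fset \<Rightarrow> 'v) \<Rightarrow> 'v cell \<Rightarrow> bool" where
  "chart n \<phi> c \<longleftrightarrow> inj_on \<phi> (std_vertices n) \<and> c = map_cell \<phi> (std_cube n)"

definition cell_points :: "'v cell \<Rightarrow> 'v point set" where
  "cell_points c = {map_point \<phi> (std_point n x) | n \<phi> x. chart n \<phi> c \<and> x \<in> unit_cube n}"

definition realization :: "'v cell set \<Rightarrow> 'v point set" where
  "realization K = (\<Union>c\<in>K. cell_points c)"

text \<open>
  \<open>f\<close> maps the closed cube \<open>c\<close> isometrically onto the closed cube \<open>d\<close>, where cubes carry the
  Euclidean metric of \<open>[0,1]\<^sup>n\<close>. Changes of charts of a cell are isometries, so the choice of
  charts does not matter.
\<close>
definition isometric_onto :: "('u point \<Rightarrow> 'v point) \<Rightarrow> 'u cell \<Rightarrow> 'v cell \<Rightarrow> bool" where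
  "isometric_onto f c d \<longleftrightarrow>
     (\<exists>m \<phi> n \<psi> h. chart m \<phi> c \<and> chart n \<psi> d \<and>
        h ` unit_cube m = unit_cube n \<and>
        (\<forall>x\<in>unit_cube m. \<forall>y\<in>unit_cube m.
           L2_set (\<lambda>i. h x i - h y i) {..<n} = L2_set (\<lambda>i. x i - y i) {..<m}) \<and>
        (\<forall>x\<in>unit_cube m.
           f (map_point \<phi> (std_point m x)) = map_point \<psi> (std_point n (h x))))"

definition cubical_embedding ::
  "'u cell set \<Rightarrow> 'v cell set \<Rightarrow> ('u point \<Rightarrow> 'v point) \<Rightarrow> bool" where
  "cubical_embedding K M f \<longleftrightarrow>
     inj_on f (realization K) \<and> (\<forall>c\<in>K. \<exists>d\<in>M. isometric_onto f c d)"

definition identity_on_vertices ::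
  "'v cell set \<Rightarrow> 'v cell set \<Rightarrow> ('v point \<Rightarrow> 'v point) \<Rightarrow> bool" where
  "identity_on_vertices K M f \<longleftrightarrow>
     (\<forall>v. Vert v \<in> K \<longrightarrow> Vert v \<in> M \<and> f (vertex_point v) = vertex_point v)"

text \<open>
  The action of \<open>G\<close> on the points is induced by an action on the vertices. The first and third
  conjuncts say that both complexes are invariant, as is implicit in equivariance.
\<close>
definition equivariant_map ::
  "('a, 'b) monoid_scheme \<Rightarrow> ('a \<Rightarrow> 'u \<Rightarrow> 'u) \<Rightarrow> ('a \<Rightarrow> 'v \<Rightarrow> 'v) \<Rightarrow>
   'u cell set \<Rightarrow> 'v cell set \<Rightarrow> ('u point \<Rightarrow> 'v point) \<Rightarrow> bool" where
  "equivariant_map G actK actM K M f \<longleftrightarrow>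
     (\<forall>g\<in>carrier G. \<forall>p\<in>realization K. map_point (actK g) p \<in> realization K) \<and>
     (\<forall>g\<in>carrier G. \<forall>p\<in>realization K. f (map_point (actK g) p) = map_point (actM g) (f p)) \<and>
     (\<forall>g\<in>carrier G. \<forall>p\<in>realization M. map_point (actM g) p \<in> realization M)"


section \<open>Ultrafilters and the cubed complex of a poset with involution\<close>

definition ultrafilter_on :: "'e set \<Rightarrow> ('e \<Rightarrow> 'e) \<Rightarrow> ('e \<Rightarrow> 'e \<Rightarrow> bool) \<Rightarrow> 'e set \<Rightarrow> bool" where
  "ultrafilter_on E star leq V \<longleftrightarrow>
     V \<subseteq> E \<and>
     (\<forall>A\<in>E. (A \<in> V) \<noteq> (star A \<in> V)) \<and>
     (\<forall>A\<in>V. \<forall>B\<in>E. leq A B \<longrightarrow> B \<in> V)"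

definition flip_adjacent :: "('e \<Rightarrow> 'e) \<Rightarrow> 'e set \<Rightarrow> 'e set \<Rightarrow> bool" where
  "flip_adjacent star V W \<longleftrightarrow> (\<exists>A\<in>V. W = (V - {A}) \<union> {star A})"

definition poset_complex ::
  "'e set \<Rightarrow> ('e \<Rightarrow> 'e) \<Rightarrow> ('e \<Rightarrow> 'e \<Rightarrow> bool) \<Rightarrow> 'e set cell set" where
  "poset_complex E star leq =
     cubed_complex {V. ultrafilter_on E star leq V} (flip_adjacent star)"

definition translate_vertex :: "('a, 'b) monoid_scheme \<Rightarrow> 'a \<Rightarrow> 'a set set \<Rightarrow> 'a set set" where
  "translate_vertex G g V = (\<lambda>A. g <#\<^bsub>G\<^esub> A) ` V"


section \<open>The cubing of the poset ordered by inclusion\<close>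

definition cubing_C :: "('a, 'b) monoid_scheme \<Rightarrow> nat \<Rightarrow> (nat \<Rightarrow> 'a set) \<Rightarrow> 'a set set cell set" where
  "cubing_C G n X =
     component_containing
       (poset_complex (translates G n X) (\<lambda>A. carrier G - A) (\<subseteq>))
       {{A \<in> translates G n X. g \<in> A} | g. g \<in> carrier G}"


section \<open>The cubing of the poset ordered by almost inclusion\<close>

definition finite_generating_set :: "('a, 'b) monoid_scheme \<Rightarrow> 'a set \<Rightarrow> bool" where
  "finite_generating_set G S \<longleftrightarrow> finite S \<and> S \<subseteq> carrier G \<and> generate G S = carrier G"

text \<open>The edges of the Cayley graph join \<open>g\<close> to \<open>g s\<close>, so that \<open>G\<close> acts on it on the left.\<close>
definition cayley_edges :: "('a, 'b) monoid_scheme \<Rightarrow> 'a set \<Rightarrow> 'a set set" where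
  "cayley_edges G S = {{g, g \<otimes>\<^bsub>G\<^esub> s} | g s. g \<in> carrier G \<and> s \<in> S}"

definition cayley_dist :: "('a, 'b) monoid_scheme \<Rightarrow> 'a set \<Rightarrow> 'a \<Rightarrow> 'a \<Rightarrow> nat" where
  "cayley_dist G S g h = (LEAST k. (g, h) \<in> {(x, y). {x, y} \<in> cayley_edges G S} ^^ k)"

text \<open>
  The vertices of the ball of radius \<open>R\<close>. As a subgraph, the ball also contains the edges both of
  whose endpoints are among these vertices.
\<close>
definition cayley_ball :: "('a, 'b) monoid_scheme \<Rightarrow> 'a set \<Rightarrow> real \<Rightarrow> 'a \<Rightarrow> 'a set" where
  "cayley_ball G S R g = {h \<in> carrier G. real (cayley_dist G S g h) \<le> R}"

definition coboundary :: "('a, 'b) monoid_scheme \<Rightarrow> 'a set \<Rightarrow> 'a set \<Rightarrow> 'a set set" where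
  "coboundary G S A = {e \<in> cayley_edges G S. \<exists>x y. e = {x, y} \<and> x \<in> A \<and> y \<notin> A}"

definition admissible_radius ::
  "('a, 'b) monoid_scheme \<Rightarrow> nat \<Rightarrow> (nat \<Rightarrow> 'a set) \<Rightarrow> (nat \<Rightarrow> 'a set) \<Rightarrow> 'a set \<Rightarrow> real \<Rightarrow> bool" where
  "admissible_radius G n H X S R \<longleftrightarrow>
     R > 0 \<and>
     (\<forall>A\<in>translates G n X. \<forall>B\<in>translates G n X. \<forall>g\<in>A.
        almost_incl G n H X A B \<and> cayley_ball G S R g \<subseteq> A \<longrightarrow> g \<in> B)"

definition near_sets ::
  "('a, 'b) monoid_scheme \<Rightarrow> nat \<Rightarrow> (nat \<Rightarrow> 'a set) \<Rightarrow> 'a set \<Rightarrow> real \<Rightarrow> 'a \<Rightarrow> 'a set set" where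
  "near_sets G n X S R g =
     {A \<in> translates G n X. \<exists>e\<in>coboundary G S A. e \<subseteq> cayley_ball G S R g}"

definition initial_set ::
  "('a, 'b) monoid_scheme \<Rightarrow> nat \<Rightarrow> (nat \<Rightarrow> 'a set) \<Rightarrow> 'a set \<Rightarrow> real \<Rightarrow> 'a \<Rightarrow> 'a set set" where
  "initial_set G n X S R g = {A \<in> translates G n X - near_sets G n X S R g. g \<in> A}"

definition undecided ::
  "('a, 'b) monoid_scheme \<Rightarrow> nat \<Rightarrow> (nat \<Rightarrow> 'a set) \<Rightarrow> 'a set set \<Rightarrow> 'a set set" where
  "undecided G n X U = translates G n X - (U \<union> (\<lambda>A. carrier G - A) ` U)"

inductive construction_stage ::
  "('a, 'b) monoid_scheme \<Rightarrow> nat \<Rightarrow> (nat \<Rightarrow> 'a set) \<Rightarrow> (nat \<Rightarrow> 'a set) \<Rightarrow> 'a set \<Rightarrow> real \<Rightarrow>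
   'a \<Rightarrow> 'a set set \<Rightarrow> bool"
  for G :: "('a, 'b) monoid_scheme" and n H X S R g where
  start: "construction_stage G n H X S R g
     (initial_set G n X S R g \<union>
      {B \<in> near_sets G n X S R g. \<exists>A\<in>initial_set G n X S R g. almost_incl G n H X A B})"
| step: "construction_stage G n H X S R g U \<Longrightarrow>
     A \<in> undecided G n X U \<Longrightarrow>
     (\<And>B. B \<in> undecided G n X U \<Longrightarrow> almost_incl G n H X B A \<Longrightarrow> B = A) \<Longrightarrow>
     construction_stage G n H X S R g
       (U \<union> {B \<in> undecided G n X U. almost_incl G n H X A B})"

definition basic_vertices_L ::
  "('a, 'b) monoid_scheme \<Rightarrow> nat \<Rightarrow> (nat \<Rightarrow> 'a set) \<Rightarrow> (nat \<Rightarrow> 'a set) \<Rightarrow> 'a set \<Rightarrow> real \<Rightarrow>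
   'a set set set" where
  "basic_vertices_L G n H X S R =
     {W. \<exists>g\<in>carrier G. construction_stage G n H X S R g W \<and> undecided G n X W = {}}"

definition cubing_L ::
  "('a, 'b) monoid_scheme \<Rightarrow> nat \<Rightarrow> (nat \<Rightarrow> 'a set) \<Rightarrow> (nat \<Rightarrow> 'a set) \<Rightarrow> 'a set \<Rightarrow> real \<Rightarrow>
   'a set set cell set" where
  "cubing_L G n H X S R =
     component_containing
       (poset_complex (translates G n X) (\<lambda>A. carrier G - A) (almost_incl G n H X))
       (basic_vertices_L G n H X S R)"

end

theory Submission
  imports Defs
begin

text \<open>
  The embedding is the identity: \<open>L\<close> is literally a subcomplex of \<open>C\<close>. Inclusion implies almost
  inclusion, so an ultrafilter for almost inclusion is closed upwards for inclusion as well.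
  Adjacency of two vertices depends only on the involution, and a cube exists as soon as its
  boundary does; hence the whole complex of \<open>(E, \<le>)\<close> lies in the complex of \<open>(E, \<subseteq>)\<close>, and an edge
  path in the former is an edge path in the latter.

  It remains to see that the component \<open>L\<close> lands in the component \<open>C\<close>, for which it is enough to
  join each basic vertex \<open>W\<^sub>g\<close> to the basic vertex \<open>V\<^sub>g\<close>, the set of all members of \<open>E\<close> that
  contain \<open>g\<close> (\<open>cubing_L_subset_cubing_C\<close>). Two ingredients do this. First, \<open>W\<^sub>g\<close> contains
  every element of \<open>V\<^sub>g\<close> whose coboundary avoids the ball about \<open>g\<close>. All other elements
  separate two points of the ball; the ball is finite, and only finitely many translates of an almost
  invariant set separate two given points (\<open>finite_separating_translates\<close>). So \<open>V\<^sub>g - W\<^sub>g\<close> is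
  finite. Second, two ultrafilters with finite difference are joined by an edge path, which
  exchanges the elements of the difference for their complements one at a time, minimal elements
  first (\<open>ultrafilters_connected\<close>).

  For equivariance, left translation by \<open>k\<close> is an automorphism of \<open>E\<close> with its complementation and both
  orders, and it carries the construction of a basic vertex at \<open>g\<close> to one at \<open>k g\<close>
  (\<open>stage_translate\<close>). So it preserves the two sets of basic vertices and hence both
  components (\<open>realization_poset_component_image\<close>).
\<close>

section \<open>Cubed complexes\<close>

text \<open>
  By induction on the number of free coordinates: a vertex of a face of positive dimension lies,
  for any free coordinate, in the upper or the lower facet in the direction of that coordinate.
\<close>
lemma set_std_face:
  assumes "A |\<subseteq>| B"
  shows "set_cell (std_face A B) = {e. A |\<subseteq>| e \<and> e |\<subseteq>| B}"
  using assms
proof (induction A B rule: std_face.induct)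
  case (1 A B)
  show ?case
  proof (cases "B |\<subseteq>| A")
    case True
    then show ?thesis using "1.prems" by (subst std_face.simps) auto
  next
    case False
    then obtain i where i: "i |\<in>| B |-| A" by blast
    have up: "set_cell (std_face (finsert j A) B) = {e. finsert j A |\<subseteq>| e \<and> e |\<subseteq>| B}"
      if "j |\<in>| B |-| A" for j
      using "1.IH"(1)[OF False that] that "1.prems" by auto
    have down: "set_cell (std_face A (B |-| {|j|})) = {e. A |\<subseteq>| e \<and> e |\<subseteq>| B |-| {|j|}}"
      if "j |\<in>| B |-| A" for j
      using "1.IH"(2)[OF False that] that "1.prems" by auto
    have "set_cell (std_face A B) =
        (\<Union>j\<in>fset (B |-| A). set_cell (std_face (finsert j A) B) \<union>
                              set_cell (std_face A (B |-| {|j|})))"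
      using False by (subst std_face.simps) auto
    also have "\<dots> = (\<Union>j\<in>fset (B |-| A). {e. finsert j A |\<subseteq>| e \<and> e |\<subseteq>| B} \<union>
                              {e. A |\<subseteq>| e \<and> e |\<subseteq>| B |-| {|j|}})"
      by (intro SUP_cong refl) (simp only: up down)
    also have "\<dots> = {e. A |\<subseteq>| e \<and> e |\<subseteq>| B}"
      using i by (auto 0 4)
    finally show ?thesis .
  qed
qed

lemma set_std_cube: "set_cell (std_cube n) = std_vertices n"
  by (simp add: std_cube_def std_vertices_def set_std_face)

lemma finite_std_vertices: "finite (std_vertices n)"
proof -
  have "std_vertices n = fset (fPow (coords n))"
    by (auto simp: std_vertices_def)
  then show ?thesis by simp
qed

text \<open>
  The rule for attaching a cube speaks only about its facets. By this lemma the facets control all of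
  its vertices.
\<close>
lemma std_vertices_in_facets:
  assumes "0 < n"
  shows "std_vertices n = (\<Union>F\<in>std_facets n. set_cell F)"
proof -
  have mem: "i |\<in>| coords n \<longleftrightarrow> i < n" for i
    by (simp add: coords_def fset_of_list.rep_eq)
  have "\<not> coords n |\<subseteq>| {||}"
    using assms mem by auto
  then have "set_cell (std_cube n) = (\<Union>F\<in>std_facets n. set_cell F)"
    unfolding std_cube_def std_facets_def
    by (subst std_face.simps) (auto simp: mem)
  then show ?thesis by (simp add: set_std_cube)
qed

lemma chart_vertices:
  assumes "chart n \<phi> c"
  shows "\<phi> ` std_vertices n = set_cell c"
  using assms by (simp add: chart_def cell.set_map set_std_cube)

lemma n_cube_vertices:
  assumes "n_cube Vs adj n c"
  shows "set_cell c \<subseteq> Vs"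
  using assms
proof induction
  case (cube n \<phi>)
  then have "\<phi> ` set_cell F \<subseteq> Vs" if "F \<in> std_facets n" for F
    using that by (metis cell.set_map)
  then show ?case
    using cube.hyps(1) by (auto simp: cell.set_map set_std_cube std_vertices_in_facets)
qed auto

lemma n_cube_mono:
  assumes "n_cube Vs adj n c" "Vs \<subseteq> Ws"
  shows "n_cube Ws adj n c"
  using assms(1)
proof induction
  case (cube n \<phi>)
  show ?case
    by (rule n_cube.cube[OF cube.hyps(1,2)]) (rule cube.IH)
next
  case (edge v w)
  then show ?case using assms(2) by (intro n_cube.edge) auto
qed (use assms(2) in \<open>auto intro: n_cube.vertex\<close>)

text \<open>
  For dimension at least 2 the attaching map is a chart. For edges the two ends must be different,
  which is why \<open>adj\<close> has to be irreflexive.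
\<close>
lemma n_cube_has_chart:
  assumes "n_cube Vs adj n c" and irrefl: "\<And>v. v \<in> Vs \<Longrightarrow> \<not> adj v v"
  shows "\<exists>\<phi>. chart n \<phi> c"
  using assms(1)
proof cases
  case (vertex v)
  have "std_cube 0 = Vert {||}"
    by (simp add: std_cube_def coords_def std_face.simps)
  then have "chart 0 (\<lambda>_. v) (Vert v)"
    by (simp add: chart_def std_vertices_def coords_def)
  then show ?thesis using vertex by auto
next
  case (edge v w)
  have square: "std_cube 1 = Cube {|Vert {|0|}, Vert {||}|}"
    by (simp add: std_cube_def coords_def std_face.simps finsert_commute)
  let ?\<phi> = "\<lambda>e. if e = {|0|} then v else w"
  have "v \<noteq> w" using edge irrefl by auto
  then have "inj_on ?\<phi> {{||}, {|0|}}"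
    by (simp add: inj_on_def fempty_not_finsert)
  moreover have "std_vertices 1 = {{||}, {|0|}}"
    by (auto simp: std_vertices_def coords_def)
  moreover have "map_cell ?\<phi> (std_cube 1) = Cube {|Vert v, Vert w|}"
    unfolding square by (simp add: fempty_not_finsert)
  ultimately have "chart 1 ?\<phi> (Cube {|Vert v, Vert w|})"
    by (simp only: chart_def)
  then show ?thesis using edge by auto
next
  case (cube \<phi>)
  then show ?thesis by (auto simp: chart_def)
qed

lemma n_cube_map:
  assumes "n_cube Vs adj n c"
    and inj: "inj_on h Vs" and maps: "h ` Vs \<subseteq> Vs"
    and adj: "\<And>v w. v \<in> Vs \<Longrightarrow> w \<in> Vs \<Longrightarrow> adj v w \<Longrightarrow> adj (h v) (h w)"
  shows "n_cube Vs adj n (map_cell h c)"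
  using assms(1)
proof induction
  case (vertex v)
  then show ?case using maps by (auto intro: n_cube.vertex)
next
  case (edge v w)
  then have "n_cube Vs adj 1 (Cube {|Vert (h v), Vert (h w)|})"
    using maps adj by (intro n_cube.edge) auto
  then show ?case by simp
next
  case (cube n \<phi>)
  have "\<phi> ` set_cell F \<subseteq> Vs" if "F \<in> std_facets n" for F
    using n_cube_vertices[OF cube.hyps(3)[OF that]] by (simp add: cell.set_map)
  then have "\<phi> ` std_vertices n \<subseteq> Vs"
    using cube.hyps(1) by (auto simp: std_vertices_in_facets)
  then have "inj_on (h \<circ> \<phi>) (std_vertices n)"
    using cube.hyps(2) inj by (meson comp_inj_on inj_on_subset)
  moreover have "n_cube Vs adj (n - 1) (map_cell (h \<circ> \<phi>) F)" if "F \<in> std_facets n" for F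
    using cube.IH[OF that] by (simp add: cell.map_comp)
  ultimately have "n_cube Vs adj n (map_cell (h \<circ> \<phi>) (std_cube n))"
    using cube.hyps(1) by (intro n_cube.cube)
  then show ?case by (simp add: cell.map_comp)
qed

text \<open>
  The image of an edge path from a base vertex is an edge path from the image of that base vertex,
  which is again a base vertex.
\<close>
lemma component_map:
  fixes Vs :: "'v set" and adj
  defines "K \<equiv> cubed_complex Vs adj"
  assumes c: "c \<in> component_containing K B"
    and inj: "inj_on h Vs" and maps: "h ` Vs \<subseteq> Vs"
    and adj: "\<And>v w. v \<in> Vs \<Longrightarrow> w \<in> Vs \<Longrightarrow> adj v w \<Longrightarrow> adj (h v) (h w)"
    and base: "\<And>b. b \<in> B \<Longrightarrow> b \<in> Vs \<Longrightarrow> h b \<in> B"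
  shows "map_cell h c \<in> component_containing K B"
proof -
  have K: "map_cell h d \<in> K" if "d \<in> K" for d
  proof -
    obtain n where "n_cube Vs adj n d"
      using \<open>d \<in> K\<close> unfolding K_def cubed_complex_def by blast
    then have "n_cube Vs adj n (map_cell h d)"
      using inj maps adj by (rule n_cube_map)
    then show ?thesis
      unfolding K_def cubed_complex_def by blast
  qed
  have edge: "edge_joined K (h v) (h w)" if "edge_joined K v w" for v w
    using that K[of "Vert v"] K[of "Vert w"] K[of "Cube {|Vert v, Vert w|}"]
    by (simp add: edge_joined_def)
  have path: "(edge_joined K)\<^sup>*\<^sup>* (h v) (h w)" if "(edge_joined K)\<^sup>*\<^sup>* v w" for v w
    using that
  proof induction
    case (step w z)
    then show ?case using edge by (meson rtranclp.rtrancl_into_rtrancl)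
  qed simp
  have "\<exists>b\<in>B. Vert b \<in> K \<and> (edge_joined K)\<^sup>*\<^sup>* b (h v)" if v: "v \<in> set_cell c" for v
  proof -
    obtain b where b: "b \<in> B" "Vert b \<in> K" "(edge_joined K)\<^sup>*\<^sup>* b v"
      using c v unfolding component_containing_def by blast
    then obtain m where "n_cube Vs adj m (Vert b)"
      unfolding K_def cubed_complex_def by blast
    then have "b \<in> Vs"
      using n_cube_vertices by fastforce
    then have "h b \<in> B" "Vert (h b) \<in> K" "(edge_joined K)\<^sup>*\<^sup>* (h b) (h v)"
      using b base path K[of "Vert b"] by simp_all
    then show ?thesis by blast
  qed
  moreover have "c \<in> K" using c unfolding component_containing_def by blast
  ultimately show ?thesis
    using K unfolding component_containing_def by (auto simp: cell.set_map)
qed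

text \<open>
  Pushing weights forward is functorial. The sum defining the second push-forward runs over the
  vertices whose pushed weight is nonzero; in an abstract weight function terms may cancel, so the sum
  is first extended by zeros to all images of vertices of nonzero weight, and then regrouped.
\<close>
lemma map_point_comp:
  assumes "finite {u. snd p u \<noteq> 0}"
  shows "map_point g (map_point f p) = map_point (g \<circ> f) p"
proof -
  let ?q = "snd p"
  let ?w = "\<lambda>w. \<Sum>u | ?q u \<noteq> 0 \<and> f u = w. ?q u"
  have "(\<Sum>w | ?w w \<noteq> 0 \<and> g w = v. ?w w) = (\<Sum>u | ?q u \<noteq> 0 \<and> (g \<circ> f) u = v. ?q u)" for v
  proof -
    let ?T = "{u. ?q u \<noteq> 0 \<and> g (f u) = v}"
    have fin: "finite ?T" using assms by (rule rev_finite_subset) auto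
    have "(\<Sum>w | ?w w \<noteq> 0 \<and> g w = v. ?w w) = (\<Sum>w\<in>f ` ?T. ?w w)"
    proof (rule sum.mono_neutral_left)
      show "{w. ?w w \<noteq> 0 \<and> g w = v} \<subseteq> f ` ?T"
      proof safe
        fix w assume "?w w \<noteq> 0" "v = g w"
        then have "{u. ?q u \<noteq> 0 \<and> f u = w} \<noteq> {}" by (metis sum.empty)
        then show "w \<in> f ` {u. ?q u \<noteq> 0 \<and> g (f u) = g w}" by auto
      qed
    qed (use fin in auto)
    also have "\<dots> = (\<Sum>w\<in>f ` ?T. \<Sum>u\<in>{u \<in> ?T. f u = w}. ?q u)"
      by (intro sum.cong) auto
    also have "\<dots> = sum ?q ?T"
      using fin by (intro sum.group) auto
    finally show ?thesis by simp
  qed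
  then show ?thesis
    by (simp add: map_point_def cell.map_comp fun_eq_iff)
qed

lemma realization_component_map:
  fixes Vs :: "'v set" and adj B
  defines "M \<equiv> component_containing (cubed_complex Vs adj) B"
  assumes p: "p \<in> realization M"
    and inj: "inj_on h Vs" and maps: "h ` Vs \<subseteq> Vs"
    and adj: "\<And>v w. v \<in> Vs \<Longrightarrow> w \<in> Vs \<Longrightarrow> adj v w \<Longrightarrow> adj (h v) (h w)"
    and base: "\<And>b. b \<in> B \<Longrightarrow> b \<in> Vs \<Longrightarrow> h b \<in> B"
  shows "map_point h p \<in> realization M"
proof -
  obtain c n \<phi> x where c: "c \<in> M" and ch: "chart n \<phi> c" and x: "x \<in> unit_cube n"
    and p_eq: "p = map_point \<phi> (std_point n x)"
    using p unfolding realization_def cell_points_def by blast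
  have "set_cell c \<subseteq> Vs"
    using c n_cube_vertices unfolding M_def component_containing_def cubed_complex_def by blast
  then have "inj_on h (\<phi> ` std_vertices n)"
    using inj inj_on_subset chart_vertices[OF ch] by metis
  then have "chart n (h \<circ> \<phi>) (map_cell h c)"
    using ch by (auto simp: chart_def cell.map_comp intro: comp_inj_on)
  moreover have "finite {e. snd (std_point n x) e \<noteq> 0}"
    by (rule finite_subset[OF _ finite_std_vertices[of n]]) (auto simp: std_point_def)
  then have "map_point h p = map_point (h \<circ> \<phi>) (std_point n x)"
    unfolding p_eq by (rule map_point_comp)
  ultimately have "map_point h p \<in> cell_points (map_cell h c)"
    using x unfolding cell_points_def by blast
  moreover have "map_cell h c \<in> M"
    using component_map[OF c[unfolded M_def] inj maps adj base] unfolding M_def .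
  ultimately show ?thesis
    unfolding realization_def by blast
qed

lemma identity_isometric_onto:
  assumes "chart n \<phi> c"
  shows "isometric_onto (\<lambda>p. p) c c"
  unfolding isometric_onto_def
  by (rule exI[of _ n], rule exI[of _ \<phi>], rule exI[of _ n], rule exI[of _ \<phi>],
      rule exI[of _ "\<lambda>x. x"]) (use assms in simp)

section \<open>Ultrafilters on a poset with involution\<close>

lemma ultrafilter_onI:
  assumes "V \<subseteq> E"
    and "\<And>A. A \<in> E \<Longrightarrow> (A \<in> V) \<noteq> (star A \<in> V)"
    and "\<And>A B. A \<in> V \<Longrightarrow> B \<in> E \<Longrightarrow> leq A B \<Longrightarrow> B \<in> V"
  shows "ultrafilter_on E star leq V"
  using assms unfolding ultrafilter_on_def by blast

lemma flip_adjacent_irrefl: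
  assumes "ultrafilter_on E star leq V"
  shows "\<not> flip_adjacent star V V"
  using assms unfolding ultrafilter_on_def flip_adjacent_def by blast

lemma ultrafilter_on_mono:
  assumes "ultrafilter_on E star leq V"
    and "\<And>A B. A \<in> E \<Longrightarrow> B \<in> E \<Longrightarrow> leq' A B \<Longrightarrow> leq A B"
  shows "ultrafilter_on E star leq' V"
  using assms unfolding ultrafilter_on_def by blast

text \<open>
  An order with more relations has fewer ultrafilters, while adjacency is the same; this is what makes the
  comparison map an inclusion of complexes.
\<close>
lemma poset_complex_mono:
  assumes "\<And>A B. A \<in> E \<Longrightarrow> B \<in> E \<Longrightarrow> leq' A B \<Longrightarrow> leq A B"
  shows "poset_complex E star leq \<subseteq> poset_complex E star leq'"
proof -
  have "{V. ultrafilter_on E star leq V} \<subseteq> {V. ultrafilter_on E star leq' V}"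
    using ultrafilter_on_mono[of E star leq _ leq'] assms by blast
  then show ?thesis
    using n_cube_mono unfolding poset_complex_def cubed_complex_def by blast
qed

text \<open>
  Exchanging \<open>A\<close> for \<open>A\<^sup>*\<close> could violate upward closure in three ways. If some other \<open>B\<close> of \<open>V\<close> lies
  below \<open>A\<close>, then \<open>B\<close> is not in \<open>W\<close> because \<open>A\<close> is not, against the minimality of \<open>A\<close> in \<open>V - W\<close>.
  If \<open>A\<^sup>*\<close> lies below some \<open>D\<close> outside \<open>V\<close> other than \<open>A\<^sup>*\<close>, then \<open>D\<^sup>*\<close> is such a \<open>B\<close>. And \<open>A\<^sup>*\<close> cannot
  lie below \<open>A\<close>, since \<open>A\<^sup>*\<close> is in \<open>W\<close> and \<open>A\<close> is not.
\<close>
lemma ultrafilter_flip_minimal: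
  assumes V: "ultrafilter_on E star leq V" and W: "ultrafilter_on E star leq W"
    and star: "\<And>A. A \<in> E \<Longrightarrow> star A \<in> E" "\<And>A. A \<in> E \<Longrightarrow> star (star A) = A"
    and anti: "\<And>A B. A \<in> E \<Longrightarrow> B \<in> E \<Longrightarrow> leq A B \<Longrightarrow> leq (star B) (star A)"
    and A: "A \<in> V - W" and min: "\<And>B. B \<in> V - W \<Longrightarrow> leq B A \<Longrightarrow> B = A"
  shows "ultrafilter_on E star leq (V - {A} \<union> {star A})"
proof -
  have AE: "A \<in> E" using A V unfolding ultrafilter_on_def by blast
  then have A': "star A \<in> W" "star A \<notin> V"
    using A V W unfolding ultrafilter_on_def by blast+
  have up: "D \<in> V - {A} \<union> {star A}"
    if B: "B \<in> V - {A} \<union> {star A}" and D: "D \<in> E" "leq B D" for B D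
  proof (cases "B = star A")
    case True
    then have DW: "D \<in> W" using W A' D unfolding ultrafilter_on_def by blast
    show ?thesis
    proof (cases "D \<in> V")
      case True
      then show ?thesis using DW A by auto
    next
      case False
      then have "star D \<in> V - W"
        using D(1) DW V W unfolding ultrafilter_on_def by blast
      moreover have "leq (star D) A"
        using anti[OF star(1)[OF AE] D(1)] D(2) True star(2)[OF AE] by simp
      ultimately have "star D = A" by (rule min)
      then show ?thesis using star(2)[OF D(1)] by simp
    qed
  next
    case False
    then have BV: "B \<in> V" "B \<noteq> A" using B by auto
    have "D \<noteq> A"
    proof
      assume "D = A"
      then have "B \<notin> W" using D W A unfolding ultrafilter_on_def by blast
      then show False using BV D min[of B] \<open>D = A\<close> by blast
    qed
    then show ?thesis using BV D V unfolding ultrafilter_on_def by blast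
  qed
  have one: "(B \<in> V - {A} \<union> {star A}) \<noteq> (star B \<in> V - {A} \<union> {star A})" if "B \<in> E" for B
  proof -
    have "star B = A \<longleftrightarrow> B = star A" "star B = star A \<longleftrightarrow> B = A"
      using star(2)[OF that] star(2)[OF AE] by metis+
    moreover have "(B \<in> V) \<noteq> (star B \<in> V)"
      using V that unfolding ultrafilter_on_def by blast
    ultimately show ?thesis
      using A A' by (metis DiffD1 Un_iff Diff_iff singleton_iff)
  qed
  have "V - {A} \<union> {star A} \<subseteq> E"
    using V star(1)[OF AE] unfolding ultrafilter_on_def by blast
  then show ?thesis
    using one up by (rule ultrafilter_onI)
qed

text \<open>
  Each flip of a minimal element of \<open>V - W\<close> removes exactly that element from the difference. An
  ultrafilter contained in another equals it, so the path ends at \<open>W\<close>.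
\<close>
lemma ultrafilters_connected:
  fixes E star leq
  defines "K \<equiv> poset_complex E star leq"
  assumes "ultrafilter_on E star leq V" and W: "ultrafilter_on E star leq W"
    and star: "\<And>A. A \<in> E \<Longrightarrow> star A \<in> E" "\<And>A. A \<in> E \<Longrightarrow> star (star A) = A"
    and anti: "\<And>A B. A \<in> E \<Longrightarrow> B \<in> E \<Longrightarrow> leq A B \<Longrightarrow> leq (star B) (star A)"
    and order: "antisymp leq" "transp leq"
    and "finite (V - W)"
  shows "(edge_joined K)\<^sup>*\<^sup>* V W"
  using assms(2) \<open>finite (V - W)\<close>
proof (induction "card (V - W)" arbitrary: V)
  case 0
  then have "V \<subseteq> W" by auto
  then have "V = W" using 0(2) W unfolding ultrafilter_on_def by blast
  then show ?case by simp
next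
  case (Suc k)
  let ?less = "\<lambda>A B. leq A B \<and> A \<noteq> B"
  have "V - W \<noteq> {}" using Suc.hyps(2) by (metis card.empty nat.distinct(1))
  moreover have "asymp_on (V - W) ?less" "transp_on (V - W) ?less"
    using order by (auto intro!: asymp_onI transp_onI dest: antisympD transpD)
  ultimately obtain A where A: "A \<in> V - W" and min: "\<And>B. B \<in> V - W \<Longrightarrow> leq B A \<Longrightarrow> B = A"
    using Finite_Set.bex_min_element[of "V - W" ?less] Suc.prems(2) by blast
  let ?V' = "V - {A} \<union> {star A}"
  have V': "ultrafilter_on E star leq ?V'"
    by (rule ultrafilter_flip_minimal[OF Suc.prems(1) W star anti A min])
  have "star A \<in> W"
    using A W Suc.prems(1) unfolding ultrafilter_on_def by blast
  then have diff: "?V' - W = (V - W) - {A}" by auto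
  have "(edge_joined K)\<^sup>*\<^sup>* ?V' W"
  proof (rule Suc.hyps(1)[OF _ V'])
    show "k = card (?V' - W)"
      using Suc.hyps(2) A Suc.prems(2) unfolding diff by simp
    show "finite (?V' - W)"
      using Suc.prems(2) unfolding diff by simp
  qed
  moreover have "edge_joined K V ?V'"
  proof -
    have "flip_adjacent star V ?V'" using A unfolding flip_adjacent_def by blast
    then have "n_cube {V. ultrafilter_on E star leq V} (flip_adjacent star) 1
        (Cube {|Vert V, Vert ?V'|})"
      using V' Suc.prems(1) by (intro n_cube.edge) auto
    moreover have "n_cube {V. ultrafilter_on E star leq V} (flip_adjacent star) 0 (Vert U)"
      if "ultrafilter_on E star leq U" for U
      using that by (intro n_cube.vertex) auto
    ultimately show ?thesis
      using V' Suc.prems(1)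
      unfolding edge_joined_def K_def poset_complex_def cubed_complex_def by blast
  qed
  ultimately show ?case by (rule converse_rtranclp_into_rtranclp[rotated])
qed

lemma ultrafilter_image:
  assumes V: "ultrafilter_on E star leq V"
    and bij: "bij_betw \<alpha> E E"
    and star: "\<And>A. A \<in> E \<Longrightarrow> star A \<in> E" "\<And>A. A \<in> E \<Longrightarrow> \<alpha> (star A) = star (\<alpha> A)"
    and leq: "\<And>A B. A \<in> E \<Longrightarrow> B \<in> E \<Longrightarrow> leq (\<alpha> A) (\<alpha> B) \<Longrightarrow> leq A B"
  shows "ultrafilter_on E star leq (\<alpha> ` V)"
proof -
  have VE: "V \<subseteq> E" using V unfolding ultrafilter_on_def by blast
  have inj: "inj_on \<alpha> E" and img: "\<alpha> ` E = E"
    using bij by (auto simp: bij_betw_def)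
  have mem: "\<alpha> A \<in> \<alpha> ` V \<longleftrightarrow> A \<in> V" if "A \<in> E" for A
    using inj that VE by (rule inj_on_image_mem_iff)
  have one: "(B \<in> \<alpha> ` V) \<noteq> (star B \<in> \<alpha> ` V)" if "B \<in> E" for B
  proof -
    from that have "B \<in> \<alpha> ` E" by (simp add: img)
    then obtain A where A: "A \<in> E" "B = \<alpha> A" by (elim imageE)
    have "(A \<in> V) \<noteq> (star A \<in> V)"
      using A(1) V unfolding ultrafilter_on_def by blast
    then show ?thesis
      unfolding A(2) star(2)[OF A(1), symmetric] mem[OF A(1)] mem[OF star(1)[OF A(1)]] .
  qed
  have up: "C \<in> \<alpha> ` V" if "B \<in> \<alpha> ` V" "C \<in> E" "leq B C" for B C
  proof -
    from that have "C \<in> \<alpha> ` E" by (simp add: img)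
    then obtain D where D: "D \<in> E" "C = \<alpha> D" by (elim imageE)
    from \<open>B \<in> \<alpha> ` V\<close> obtain A where A: "A \<in> V" "B = \<alpha> A" by (elim imageE)
    have "leq A D" using leq[of A D] that(3) A D VE by auto
    then have "D \<in> V" using A D V unfolding ultrafilter_on_def by blast
    then show ?thesis using D by simp
  qed
  have "\<alpha> ` V \<subseteq> E" using image_mono[OF VE, of \<alpha>] img by simp
  then show ?thesis
    using one up by (rule ultrafilter_onI)
qed

lemma flip_adjacent_image:
  assumes "flip_adjacent star V W" and "V \<subseteq> E" and inj: "inj_on \<alpha> E"
    and star: "\<And>A. A \<in> E \<Longrightarrow> \<alpha> (star A) = star (\<alpha> A)"
  shows "flip_adjacent star (\<alpha> ` V) (\<alpha> ` W)"
proof -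
  obtain A where A: "A \<in> V" "W = V - {A} \<union> {star A}"
    using assms(1) unfolding flip_adjacent_def by blast
  have "\<alpha> ` (V - {A}) = \<alpha> ` V - {\<alpha> A}"
    using inj_on_image_set_diff[OF inj, of V "{A}"] A \<open>V \<subseteq> E\<close> by auto
  then have "\<alpha> ` W = \<alpha> ` V - {\<alpha> A} \<union> {star (\<alpha> A)}"
    using A star \<open>V \<subseteq> E\<close> by auto
  then show ?thesis using A unfolding flip_adjacent_def by blast
qed

text \<open>
  An automorphism of the poset with involution acts on its ultrafilters by taking images. Only one
  direction of the equivalence for the order is assumed, since upward closure of an image is tested
  by pulling back.
\<close>
lemma realization_poset_component_image:
  fixes E star leq B
  defines "M \<equiv> component_containing (poset_complex E star leq) B"
  assumes "p \<in> realization M"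
    and bij: "bij_betw \<alpha> E E"
    and star: "\<And>A. A \<in> E \<Longrightarrow> star A \<in> E" "\<And>A. A \<in> E \<Longrightarrow> \<alpha> (star A) = star (\<alpha> A)"
    and leq: "\<And>A B. A \<in> E \<Longrightarrow> B \<in> E \<Longrightarrow> leq (\<alpha> A) (\<alpha> B) \<Longrightarrow> leq A B"
    and base: "\<And>b. b \<in> B \<Longrightarrow> \<alpha> ` b \<in> B"
  shows "map_point (\<lambda>V. \<alpha> ` V) p \<in> realization M"
proof -
  let ?Vs = "{V. ultrafilter_on E star leq V}"
  have sub: "?Vs \<subseteq> Pow E" by (auto simp: ultrafilter_on_def)
  have inj: "inj_on \<alpha> E" using bij by (simp add: bij_betw_def)
  show ?thesis
    unfolding M_def poset_complex_def
  proof (rule realization_component_map)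
    show "inj_on (\<lambda>V. \<alpha> ` V) ?Vs"
      using inj sub by (meson inj_on_image_Pow inj_on_subset)
    show "(\<lambda>V. \<alpha> ` V) ` ?Vs \<subseteq> ?Vs"
    proof (intro image_subsetI CollectI)
      fix V assume "V \<in> ?Vs"
      then have "ultrafilter_on E star leq V" by simp
      then show "ultrafilter_on E star leq (\<alpha> ` V)"
        using bij star leq by (rule ultrafilter_image)
    qed
    show "flip_adjacent star (\<alpha> ` V) (\<alpha> ` W)"
      if "V \<in> ?Vs" "flip_adjacent star V W" for V W
      by (rule flip_adjacent_image[of star V W E]) (use that sub inj star(2) in blast)+
    show "p \<in> realization (component_containing (cubed_complex ?Vs (flip_adjacent star)) B)"
      using assms(2) unfolding M_def poset_complex_def .
  qed (rule base)
qed

section \<open>Translates of subsets of a group\<close>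

context group
begin

lemma mem_l_coset_iff:
  assumes "x \<in> carrier G" "g \<in> carrier G" "A \<subseteq> carrier G"
  shows "x \<in> g <# A \<longleftrightarrow> inv g \<otimes> x \<in> A"
proof
  assume "x \<in> g <# A"
  then obtain a where "a \<in> A" "x = g \<otimes> a"
    unfolding l_coset_def by blast
  then show "inv g \<otimes> x \<in> A"
    using assms by (auto simp: m_assoc[symmetric])
next
  assume "inv g \<otimes> x \<in> A"
  moreover have "x = g \<otimes> (inv g \<otimes> x)"
    using assms by (simp add: m_assoc[symmetric])
  ultimately show "x \<in> g <# A"
    unfolding l_coset_def by blast
qed

lemma l_coset_cancel:
  assumes "g \<in> carrier G" "A \<subseteq> carrier G"
  shows "inv g <# (g <# A) = A" "g <# (inv g <# A) = A"
  using assms by (simp_all add: lcos_m_assoc lcos_mult_one)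

lemma l_coset_complement:
  assumes "g \<in> carrier G" "A \<subseteq> carrier G"
  shows "g <# (carrier G - A) = carrier G - (g <# A)"
proof -
  have "x \<in> g <# (carrier G - A) \<longleftrightarrow> x \<in> carrier G - (g <# A)" for x
  proof (cases "x \<in> carrier G")
    case True
    then show ?thesis
      using assms by (simp add: mem_l_coset_iff)
  next
    case False
    then show ?thesis
      using l_coset_subset_G[of "carrier G - A" g] assms by blast
  qed
  then show ?thesis by blast
qed

lemma l_coset_Int:
  assumes "g \<in> carrier G" "A \<subseteq> carrier G" "B \<subseteq> carrier G"
  shows "g <# (A \<inter> B) = (g <# A) \<inter> (g <# B)"
proof -
  have "x \<in> g <# (A \<inter> B) \<longleftrightarrow> x \<in> (g <# A) \<inter> (g <# B)" for x
  proof (cases "x \<in> carrier G")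
    case True
    moreover have "A \<inter> B \<subseteq> carrier G" using assms by blast
    ultimately show ?thesis
      using assms by (simp add: mem_l_coset_iff)
  next
    case False
    then show ?thesis
      using l_coset_subset_G[of A g] l_coset_subset_G[of "A \<inter> B" g] assms by blast
  qed
  then show ?thesis by blast
qed

lemma corner_translate:
  assumes "g \<in> carrier G" "U \<subseteq> carrier G" "V \<subseteq> carrier G"
  shows "corner G p (g <# U) (g <# V) = g <# corner G p U V"
  using assms by (simp add: corner_def l_coset_Int l_coset_complement)

lemma corner_subset:
  assumes "U \<subseteq> carrier G"
  shows "corner G p U V \<subseteq> carrier G"
  using assms by (auto simp: corner_def)

lemma subgroup_finite_translate:
  assumes "subgroup_finite G K Y" "g \<in> carrier G" "K \<subseteq> carrier G" "Y \<subseteq> carrier G"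
  shows "subgroup_finite G ((g <# K) #> inv g) (g <# Y)"
proof -
  obtain F where F: "finite F" "F \<subseteq> carrier G" "Y \<subseteq> (\<Union>f\<in>F. K #> f)"
    using assms(1) unfolding subgroup_finite_def by blast
  have shift: "((g <# K) #> inv g) #> (g \<otimes> f) = g <# (K #> f)" if "f \<in> F" for f
  proof -
    have f: "f \<in> carrier G" using that F by blast
    have "((g <# K) #> inv g) #> (g \<otimes> f) = (g <# K) #> (inv g \<otimes> (g \<otimes> f))"
      using assms f by (simp add: coset_mult_assoc l_coset_subset_G)
    also have "\<dots> = g <# (K #> f)"
      using assms f by (simp add: m_assoc[symmetric] coset_assoc)
    finally show ?thesis .
  qed
  have "g <# Y \<subseteq> (\<Union>f\<in>F. g <# (K #> f))"
    using F(3) unfolding l_coset_def by blast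
  also have "\<dots> = (\<Union>f\<in>(\<lambda>f. g \<otimes> f) ` F. ((g <# K) #> inv g) #> f)"
    by (simp add: shift)
  finally show ?thesis
    unfolding subgroup_finite_def using F assms(2)
    by (intro exI[of _ "(\<lambda>f. g \<otimes> f) ` F"]) auto
qed

text \<open>
  Suppose that \<open>g Y\<close> contains \<open>x\<close> but not \<open>y\<close>, and put \<open>u = g\<inverse> x\<close>, \<open>v = g\<inverse> y\<close> and
  \<open>s = x\<inverse> y\<close>. Then \<open>u s = v\<close>, so the coset \<open>H v\<close> lies in \<open>(H\<setminus>Y) s\<close> but not in \<open>H\<setminus>Y\<close>; by
  almost invariance there are finitely many such cosets. The coset \<open>H v\<close> determines
  \<open>v\<inverse> Y\<close>, as \<open>H\<close> fixes \<open>Y\<close>, and hence determines \<open>g Y = y v\<inverse> Y\<close>.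
\<close>
lemma finite_separating_translates:
  assumes H: "subgroup H G" and Y: "almost_invariant_over G H Y"
    and xy: "x \<in> carrier G" "y \<in> carrier G"
  shows "finite {g <# Y | g. g \<in> carrier G \<and> x \<in> g <# Y \<and> y \<notin> g <# Y}"
proof -
  let ?s = "inv x \<otimes> y" and ?Q = "left_quotient G H Y"
  have YG: "Y \<subseteq> carrier G" and HY: "\<And>h. h \<in> H \<Longrightarrow> h <# Y = Y"
    using Y unfolding almost_invariant_over_def by auto
  have HG: "H \<subseteq> carrier G" using H by (rule subgroup.subset)
  have s: "?s \<in> carrier G" using xy by simp
  let ?D = "(\<lambda>P. P #> ?s) ` ?Q - ?Q"
  have D: "finite ?D"
    using Y s unfolding almost_invariant_over_def almost_invariant_def almost_equal_def by blast
  \<comment> \<open>The finite set \<open>D\<close> of cosets maps onto the separating translates via a choice of \<open>v\<close>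
    in each coset; any choice gives the same translate.\<close>
  let ?rep = "\<lambda>P. SOME z. z \<in> P"
  have "g <# Y \<in> (\<lambda>P. y <# (inv (?rep P) <# Y)) ` ?D"
    if g: "g \<in> carrier G" "x \<in> g <# Y" "y \<notin> g <# Y" for g
  proof -
    let ?u = "inv g \<otimes> x" and ?v = "inv g \<otimes> y"
    have u: "?u \<in> Y" and v: "?v \<notin> Y" and vG: "?v \<in> carrier G"
      using g xy YG by (auto simp: mem_l_coset_iff)
    have "?u \<otimes> ?s = ?v"
      using g xy by (metis inv_closed inv_solve_left m_assoc m_closed)
    then have "(H #> ?u) #> ?s = H #> ?v"
      using coset_mult_assoc[OF HG _ s, of ?u] u YG by auto
    then have in_img: "H #> ?v \<in> (\<lambda>P. P #> ?s) ` ?Q"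
      using u unfolding left_quotient_def by (metis imageI)
    have not_in: "H #> ?v \<notin> ?Q"
    proof
      assume "H #> ?v \<in> ?Q"
      then obtain w where w: "w \<in> Y" "H #> ?v = H #> w"
        unfolding left_quotient_def by blast
      then have "?v \<in> H #> w"
        using rcos_self[OF vG H] by simp
      then obtain h where "h \<in> H" "?v = h \<otimes> w"
        unfolding r_coset_def by blast
      then have "?v \<in> h <# Y"
        using w unfolding l_coset_def by blast
      then show False using HY \<open>h \<in> H\<close> v by blast
    qed
    have "?rep (H #> ?v) \<in> H #> ?v"
      using rcos_self[OF vG H] by (rule someI)
    then obtain h where h: "h \<in> H" "?rep (H #> ?v) = h \<otimes> ?v"
      unfolding r_coset_def by blast
    then have hG: "h \<in> carrier G" using HG by blast
    have "inv (h \<otimes> ?v) <# Y = inv ?v <# (inv h <# (h <# Y))"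
      using h hG HY vG YG by (simp add: inv_mult_group lcos_m_assoc l_coset_subset_G)
    also have "\<dots> = inv ?v <# Y"
      using hG YG by (simp add: l_coset_cancel)
    finally have "y <# (inv (?rep (H #> ?v)) <# Y) = (y \<otimes> inv ?v) <# Y"
      using h xy vG YG by (simp add: lcos_m_assoc)
    also have "y \<otimes> inv ?v = g"
      using g xy by (simp add: inv_mult_group m_assoc[symmetric])
    finally have "g <# Y = y <# (inv (?rep (H #> ?v)) <# Y)" ..
    moreover have "H #> ?v \<in> ?D"
      using in_img not_in by (rule DiffI)
    ultimately show ?thesis by (rule image_eqI)
  qed
  then have "{g <# Y | g. g \<in> carrier G \<and> x \<in> g <# Y \<and> y \<notin> g <# Y}
      \<subseteq> (\<lambda>P. y <# (inv (?rep P) <# Y)) ` ?D"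
    by blast
  then show ?thesis
    using D by (meson finite_imageI finite_subset)
qed


section \<open>Balls in the Cayley graph\<close>

abbreviation cayley_rel :: "'a set \<Rightarrow> ('a \<times> 'a) set" where
  "cayley_rel S \<equiv> {(x, y). {x, y} \<in> cayley_edges G S}"

lemma cayley_edge_cases:
  assumes "{x, y} \<in> cayley_edges G S" and "S \<subseteq> carrier G"
  shows "x \<in> carrier G" "y \<in> carrier G"
    and "(\<exists>s\<in>S. y = x \<otimes> s) \<or> (\<exists>s\<in>S. y = x \<otimes> inv s)"
proof -
  obtain g s where gs: "g \<in> carrier G" "s \<in> S" "{x, y} = {g, g \<otimes> s}"
    using assms(1) unfolding cayley_edges_def by blast
  have s: "s \<in> carrier G" using gs assms by blast
  show "x \<in> carrier G" "y \<in> carrier G"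
    using gs s by (auto simp: doubleton_eq_iff)
  have "g = g \<otimes> s \<otimes> inv s"
    using gs s by (simp add: m_assoc)
  then show "(\<exists>s\<in>S. y = x \<otimes> s) \<or> (\<exists>s\<in>S. y = x \<otimes> inv s)"
    using gs by (auto simp: doubleton_eq_iff)
qed

lemma cayley_edge_translate:
  assumes "{x, y} \<in> cayley_edges G S" "S \<subseteq> carrier G" "g \<in> carrier G"
  shows "{g \<otimes> x, g \<otimes> y} \<in> cayley_edges G S"
proof -
  obtain k s where ks: "k \<in> carrier G" "s \<in> S" "{x, y} = {k, k \<otimes> s}"
    using assms(1) unfolding cayley_edges_def by blast
  then have "{g \<otimes> x, g \<otimes> y} = {g \<otimes> k, g \<otimes> k \<otimes> s}"
    using assms by (auto simp: doubleton_eq_iff m_assoc)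
  then show ?thesis
    using ks assms unfolding cayley_edges_def by blast
qed

lemma cayley_path_translate:
  assumes S: "S \<subseteq> carrier G" and g: "g \<in> carrier G" and "(x, y) \<in> cayley_rel S ^^ k"
  shows "(g \<otimes> x, g \<otimes> y) \<in> cayley_rel S ^^ k"
  using assms(3)
proof (induction k arbitrary: y)
  case (Suc k)
  then obtain z where z: "(x, z) \<in> cayley_rel S ^^ k" "{z, y} \<in> cayley_edges G S"
    by auto
  then show ?case
    using Suc.IH[OF z(1)] cayley_edge_translate[OF z(2) S g] by auto
qed simp

lemma cayley_dist_translate:
  assumes S: "S \<subseteq> carrier G" and "g \<in> carrier G" "x \<in> carrier G" "y \<in> carrier G"
  shows "cayley_dist G S (g \<otimes> x) (g \<otimes> y) = cayley_dist G S x y"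
proof -
  have "inv g \<otimes> (g \<otimes> z) = z" if "z \<in> carrier G" for z
    using that assms by (simp add: m_assoc[symmetric])
  then have "(g \<otimes> x, g \<otimes> y) \<in> cayley_rel S ^^ k \<longleftrightarrow> (x, y) \<in> cayley_rel S ^^ k" for k
    using cayley_path_translate[OF S assms(2), of x y k]
      cayley_path_translate[OF S inv_closed[OF assms(2)], of "g \<otimes> x" "g \<otimes> y" k] assms
    by auto
  then show ?thesis by (simp add: cayley_dist_def)
qed

lemma cayley_ball_translate:
  assumes S: "S \<subseteq> carrier G" and g: "g \<in> carrier G" and "x \<in> carrier G"
    and "y \<in> cayley_ball G S R x"
  shows "g \<otimes> y \<in> cayley_ball G S R (g \<otimes> x)"
  using assms by (simp add: cayley_ball_def cayley_dist_translate)

lemma cayley_connected: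
  assumes S: "S \<subseteq> carrier G" and "t \<in> generate G S" and "x \<in> carrier G"
  shows "(x, x \<otimes> t) \<in> (cayley_rel S)\<^sup>*"
  using assms(2,3)
proof (induction arbitrary: x)
  case one
  then show ?case by simp
next
  case (incl s)
  then have "{x, x \<otimes> s} \<in> cayley_edges G S"
    unfolding cayley_edges_def by blast
  then show ?case by auto
next
  case (inv s)
  then have s: "s \<in> carrier G" using S by blast
  have "{x \<otimes> inv s, x \<otimes> inv s \<otimes> s} \<in> cayley_edges G S"
    using inv s unfolding cayley_edges_def by blast
  moreover have "x \<otimes> inv s \<otimes> s = x"
    using inv s by (simp add: m_assoc)
  ultimately have "{x, x \<otimes> inv s} \<in> cayley_edges G S"
    by (metis insert_commute)
  then show ?case by auto
next
  case (eng t u)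
  then have "t \<in> carrier G" "u \<in> carrier G"
    using generate_in_carrier[OF S] by blast+
  then show ?case
    using eng.IH(1)[OF eng.prems] eng.IH(2)[of "x \<otimes> t"] eng.prems
    by (auto simp: m_assoc)
qed

text \<open>
  The distance is a least path length, which is meaningful because the generating set makes the
  graph connected; the ball is then a finite union of finite spheres.
\<close>
lemma finite_cayley_ball:
  assumes S: "finite_generating_set G S" and x: "x \<in> carrier G"
  shows "finite (cayley_ball G S R x)"
proof -
  have SG: "finite S" "S \<subseteq> carrier G" "generate G S = carrier G"
    using S unfolding finite_generating_set_def by auto
  have step: "finite (cayley_rel S `` {y})" for y
  proof (rule finite_subset)
    show "cayley_rel S `` {y} \<subseteq> (\<lambda>s. y \<otimes> s) ` S \<union> (\<lambda>s. y \<otimes> inv s) ` S"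
      using cayley_edge_cases(3)[OF _ SG(2)] by blast
  qed (use SG in auto)
  have sphere: "finite ((cayley_rel S ^^ k) `` {x})" for k
  proof (induction k)
    case (Suc k)
    have "(cayley_rel S ^^ Suc k) `` {x} = (\<Union>y\<in>(cayley_rel S ^^ k) `` {x}. cayley_rel S `` {y})"
      by auto
    then show ?case using Suc step by simp
  qed simp
  have "y \<in> (\<Union>k\<le>nat \<lfloor>R\<rfloor>. (cayley_rel S ^^ k) `` {x})" if "y \<in> cayley_ball G S R x" for y
  proof -
    have y: "y \<in> carrier G" "real (cayley_dist G S x y) \<le> R"
      using that by (auto simp: cayley_ball_def)
    then have "(x, x \<otimes> (inv x \<otimes> y)) \<in> (cayley_rel S)\<^sup>*"
      using x SG by (intro cayley_connected) auto
    then have "(x, y) \<in> (cayley_rel S)\<^sup>*"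
      using x y by (simp add: m_assoc[symmetric])
    then have "\<exists>k. (x, y) \<in> cayley_rel S ^^ k"
      by (rule rtrancl_imp_relpow)
    then have "(x, y) \<in> cayley_rel S ^^ cayley_dist G S x y"
      unfolding cayley_dist_def by (rule LeastI_ex)
    moreover have "cayley_dist G S x y \<le> nat \<lfloor>R\<rfloor>"
      using y(2) by (simp add: le_nat_floor)
    ultimately show ?thesis by blast
  qed
  then have "cayley_ball G S R x \<subseteq> (\<Union>k\<le>nat \<lfloor>R\<rfloor>. (cayley_rel S ^^ k) `` {x})"
    by blast
  then show ?thesis
    by (rule finite_subset) (use sphere in blast)
qed

end

section \<open>The translates of a family of almost invariant sets\<close>

locale almost_invariant_family = group G for G (structure) +
  fixes n :: nat and H X :: "nat \<Rightarrow> 'a set"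
  assumes subgroup_H: "\<And>i. i \<in> {1..n} \<Longrightarrow> subgroup (H i) G"
    and almost_invariant_X: "\<And>i. i \<in> {1..n} \<Longrightarrow> almost_invariant_over G (H i) (X i)"
begin

abbreviation E :: "'a set set" where
  "E \<equiv> translates G n X"

abbreviation almost_le :: "'a set \<Rightarrow> 'a set \<Rightarrow> bool" (infix "\<preceq>" 50) where
  "A \<preceq> B \<equiv> almost_incl G n H X A B"

lemma X_subset: "i \<in> {1..n} \<Longrightarrow> X i \<subseteq> carrier G"
  using almost_invariant_X unfolding almost_invariant_over_def by blast

lemma H_subset: "i \<in> {1..n} \<Longrightarrow> H i \<subseteq> carrier G"
  using subgroup_H by (rule subgroup.subset)

lemma E_cases:
  assumes "A \<in> E"
  obtains i g where "i \<in> {1..n}" "g \<in> carrier G"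
    "A = g <# X i \<or> A = g <# (carrier G - X i)"
  using assms unfolding translates_def by blast

lemma E_subset:
  assumes "A \<in> E"
  shows "A \<subseteq> carrier G"
proof -
  obtain i g where i: "i \<in> {1..n}" and g: "g \<in> carrier G"
    and A: "A = g <# X i \<or> A = g <# (carrier G - X i)"
    using assms by (rule E_cases)
  then show ?thesis
    using l_coset_subset_G[OF X_subset[OF i] g] l_coset_subset_G[OF Diff_subset g] by metis
qed

lemma E_complement:
  assumes "A \<in> E"
  shows "carrier G - A \<in> E"
proof -
  obtain i g where i: "i \<in> {1..n}" and g: "g \<in> carrier G"
    and A: "A = g <# X i \<or> A = g <# (carrier G - X i)"
    using assms by (rule E_cases)
  have "carrier G - (g <# X i) = g <# (carrier G - X i)"
    using g X_subset[OF i] by (simp add: l_coset_complement)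
  moreover have "carrier G - (g <# (carrier G - X i)) = g <# X i"
    using g X_subset[OF i] by (metis Diff_subset double_diff l_coset_complement subset_refl)
  ultimately have "carrier G - A = g <# (carrier G - X i) \<or> carrier G - A = g <# X i"
    using A by auto
  then show ?thesis
    using i g unfolding translates_def by blast
qed

lemma E_double_complement: "A \<in> E \<Longrightarrow> carrier G - (carrier G - A) = A"
  using E_subset by blast

lemma E_translate:
  assumes "A \<in> E" "g \<in> carrier G"
  shows "g <# A \<in> E"
proof -
  obtain i k where i: "i \<in> {1..n}" and k: "k \<in> carrier G"
    and A: "A = k <# X i \<or> A = k <# (carrier G - X i)"
    using assms(1) by (rule E_cases)
  then have "g <# A = (g \<otimes> k) <# X i \<or> g <# A = (g \<otimes> k) <# (carrier G - X i)"
    using assms(2) X_subset[OF i] lcos_m_assoc by auto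
  then show ?thesis
    using i k assms(2) unfolding translates_def by blast
qed

lemma translate_bij:
  assumes "g \<in> carrier G"
  shows "bij_betw (\<lambda>A. g <# A) E E"
  using assms E_translate E_subset l_coset_cancel
  by (intro bij_betw_byWitness[of _ "\<lambda>A. inv g <# A"]) auto

lemma translate_complement:
  assumes "g \<in> carrier G" "A \<in> E"
  shows "g <# (carrier G - A) = carrier G - (g <# A)"
  using assms E_subset by (simp add: l_coset_complement)

lemma small_corner_translate:
  assumes "small_corner G n H X p U V" "g \<in> carrier G" "U \<in> E" "V \<in> E"
  shows "small_corner G n H X p (g <# U) (g <# V)"
proof -
  obtain i k where i: "i \<in> {1..n}" and k: "k \<in> carrier G"
    and U: "U = k <# X i \<or> U = k <# (carrier G - X i)"
    and fin: "subgroup_finite G ((k <# H i) #> inv k) (corner G p U V)"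
    using assms(1) unfolding small_corner_def by blast
  have sub: "U \<subseteq> carrier G" "V \<subseteq> carrier G" "corner G p U V \<subseteq> carrier G"
    using assms E_subset corner_subset by auto
  have conj: "(g <# ((k <# H i) #> inv k)) #> inv g = ((g \<otimes> k) <# H i) #> inv (g \<otimes> k)"
  proof -
    have "g <# ((k <# H i) #> inv k) = ((g \<otimes> k) <# H i) #> inv k"
      using assms k H_subset[OF i] by (simp add: coset_assoc lcos_m_assoc l_coset_subset_G)
    then show ?thesis
      using assms k H_subset[OF i]
      by (simp add: coset_mult_assoc l_coset_subset_G inv_mult_group)
  qed
  have "subgroup_finite G ((g <# ((k <# H i) #> inv k)) #> inv g) (g <# corner G p U V)"
    using fin assms(2) k H_subset[OF i] sub(3)
    by (intro subgroup_finite_translate) (auto simp: l_coset_subset_G r_coset_subset_G)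
  then have "subgroup_finite G (((g \<otimes> k) <# H i) #> inv (g \<otimes> k)) (corner G p (g <# U) (g <# V))"
    using conj assms(2) sub by (simp add: corner_translate)
  moreover have "g <# U = (g \<otimes> k) <# X i \<or> g <# U = (g \<otimes> k) <# (carrier G - X i)"
    using U assms(2) k X_subset[OF i] lcos_m_assoc by auto
  moreover have "g \<otimes> k \<in> carrier G" using k assms(2) by simp
  ultimately show ?thesis
    using i unfolding small_corner_def by blast
qed

lemma small_corner_translate_iff:
  assumes "g \<in> carrier G" "U \<in> E" "V \<in> E"
  shows "small_corner G n H X p (g <# U) (g <# V) \<longleftrightarrow> small_corner G n H X p U V"
proof
  assume "small_corner G n H X p (g <# U) (g <# V)"
  then have "small_corner G n H X p (inv g <# (g <# U)) (inv g <# (g <# V))"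
    by (rule small_corner_translate) (use assms E_translate in auto)
  then show "small_corner G n H X p U V"
    using assms E_subset by (simp add: l_coset_cancel)
qed (use small_corner_translate assms in blast)

lemma almost_incl_translate_iff:
  assumes "g \<in> carrier G" "U \<in> E" "V \<in> E"
  shows "g <# U \<preceq> g <# V \<longleftrightarrow> U \<preceq> V"
proof -
  have "corner G p (g <# U) (g <# V) = {} \<longleftrightarrow> corner G p U V = {}" for p
    using assms E_subset by (simp add: corner_translate) (simp add: l_coset_def)
  then show ?thesis
    using assms by (simp add: almost_incl_def small_corner_translate_iff)
qed

lemma subset_imp_almost_incl: "U \<in> E \<Longrightarrow> U \<subseteq> V \<Longrightarrow> U \<preceq> V"
  by (auto simp: almost_incl_def corner_def)

text \<open>
  A translate of a complement that separates \<open>x\<close> from \<open>y\<close> is the complement of a translate that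
  separates \<open>y\<close> from \<open>x\<close>.
\<close>
lemma finite_separating:
  assumes "x \<in> carrier G" "y \<in> carrier G"
  shows "finite {A \<in> E. x \<in> A \<and> y \<notin> A}"
proof -
  let ?Z = "\<lambda>i x y. {g <# X i | g. g \<in> carrier G \<and> x \<in> g <# X i \<and> y \<notin> g <# X i}"
  have fin: "finite (?Z i u v)" if "i \<in> {1..n}" "u \<in> carrier G" "v \<in> carrier G" for i u v
    using subgroup_H[OF that(1)] almost_invariant_X[OF that(1)] that(2,3)
    by (rule finite_separating_translates)
  have "{A \<in> E. x \<in> A \<and> y \<notin> A}
      \<subseteq> (\<Union>i\<in>{1..n}. ?Z i x y \<union> (\<lambda>A. carrier G - A) ` ?Z i y x)"
  proof
    fix A assume "A \<in> {A \<in> E. x \<in> A \<and> y \<notin> A}"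
    then have "A \<in> E" and xy: "x \<in> A" "y \<notin> A" by auto
    then obtain i g where i: "i \<in> {1..n}" and g: "g \<in> carrier G"
      and A: "A = g <# X i \<or> A = g <# (carrier G - X i)"
      using E_cases by blast
    from A show "A \<in> (\<Union>i\<in>{1..n}. ?Z i x y \<union> (\<lambda>A. carrier G - A) ` ?Z i y x)"
    proof
      assume "A = g <# X i"
      then have "A \<in> ?Z i x y" using g xy by blast
      then show ?thesis using i by blast
    next
      assume "A = g <# (carrier G - X i)"
      then have A': "A = carrier G - (g <# X i)"
        using g X_subset[OF i] by (simp add: l_coset_complement)
      then have "g <# X i \<in> ?Z i y x" using g xy assms by blast
      then show ?thesis using A' i by blast
    qed
  qed
  then show ?thesis
    by (rule finite_subset) (use fin assms in auto)
qed

text \<open>An edge of the coboundary inside the ball consists of two points of the ball that the set separates.\<close>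
lemma finite_near_sets:
  assumes "finite_generating_set G S" "g \<in> carrier G"
  shows "finite (near_sets G n X S R g)"
proof -
  let ?N = "cayley_ball G S R g"
  have "near_sets G n X S R g \<subseteq> (\<Union>x\<in>?N. \<Union>y\<in>?N. {A \<in> E. x \<in> A \<and> y \<notin> A})"
    unfolding near_sets_def coboundary_def by blast
  moreover have "?N \<subseteq> carrier G" by (auto simp: cayley_ball_def)
  ultimately show ?thesis
    using finite_cayley_ball[OF assms] finite_separating
    by (meson finite_UN_I finite_subset subsetD)
qed

end

section \<open>Basic vertices\<close>

context almost_invariant_family
begin

lemma initial_subset_stage:
  assumes "construction_stage G n H X S R g U"
  shows "initial_set G n X S R g \<subseteq> U"
  using assms by induction auto

lemma stage_subset:
  assumes "construction_stage G n H X S R g U"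
  shows "U \<subseteq> E"
  using assms by induction (auto simp: initial_set_def near_sets_def undecided_def)

lemma near_sets_translate:
  assumes S: "S \<subseteq> carrier G" and k: "k \<in> carrier G" and g: "g \<in> carrier G"
    and "A \<in> near_sets G n X S R g"
  shows "k <# A \<in> near_sets G n X S R (k \<otimes> g)"
proof -
  obtain x y where A: "A \<in> E" "x \<in> A" "y \<notin> A" and e: "{x, y} \<in> cayley_edges G S"
    and ball: "x \<in> cayley_ball G S R g" "y \<in> cayley_ball G S R g"
    using assms(4) unfolding near_sets_def coboundary_def by blast
  have y: "y \<in> carrier G" using cayley_edge_cases(2)[OF e S] .
  have "{k \<otimes> x, k \<otimes> y} \<in> cayley_edges G S"
    using e S k by (rule cayley_edge_translate)
  moreover have "k \<otimes> x \<in> k <# A"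
    using A unfolding l_coset_def by blast
  moreover have "k \<otimes> y \<notin> k <# A"
    using A(3) y k E_subset[OF A(1)] by (simp add: mem_l_coset_iff m_assoc[symmetric])
  ultimately have "{k \<otimes> x, k \<otimes> y} \<in> coboundary G S (k <# A)"
    unfolding coboundary_def by blast
  moreover have "{k \<otimes> x, k \<otimes> y} \<subseteq> cayley_ball G S R (k \<otimes> g)"
    using ball cayley_ball_translate[OF S k g] by blast
  ultimately show ?thesis
    using E_translate[OF A(1) k] unfolding near_sets_def by blast
qed

lemma near_sets_translate_iff:
  assumes S: "S \<subseteq> carrier G" and k: "k \<in> carrier G" and g: "g \<in> carrier G" and A: "A \<in> E"
  shows "k <# A \<in> near_sets G n X S R (k \<otimes> g) \<longleftrightarrow> A \<in> near_sets G n X S R g"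
  using near_sets_translate[OF S k g]
    near_sets_translate[OF S inv_closed[OF k] m_closed[OF k g], of "k <# A"]
    k g E_subset[OF A]
  by (auto simp: l_coset_cancel m_assoc[symmetric])

lemma initial_set_translate_iff:
  assumes "S \<subseteq> carrier G" "k \<in> carrier G" "g \<in> carrier G" "A \<in> E"
  shows "k <# A \<in> initial_set G n X S R (k \<otimes> g) \<longleftrightarrow> A \<in> initial_set G n X S R g"
  using assms E_translate E_subset
  by (auto simp: initial_set_def near_sets_translate_iff mem_l_coset_iff m_assoc[symmetric])

lemma translate_image_eqI:
  assumes k: "k \<in> carrier G" and "P \<subseteq> E" "Q \<subseteq> E"
    and "\<And>A. A \<in> E \<Longrightarrow> k <# A \<in> Q \<longleftrightarrow> A \<in> P"
  shows "(\<lambda>A. k <# A) ` P = Q"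
proof (intro equalityI subsetI)
  fix B assume "B \<in> (\<lambda>A. k <# A) ` P"
  then obtain A where "A \<in> P" "B = k <# A" by (elim imageE)
  then show "B \<in> Q" using assms by blast
next
  fix B assume B: "B \<in> Q"
  then have BE: "B \<in> E" using assms by blast
  have "k <# (inv k <# B) = B"
    using k E_subset[OF BE] by (simp add: l_coset_cancel)
  moreover have "inv k <# B \<in> E"
    using BE k by (simp add: E_translate)
  ultimately show "B \<in> (\<lambda>A. k <# A) ` P"
    using assms(4)[of "inv k <# B"] B by (metis image_eqI)
qed

lemma undecided_translate:
  assumes k: "k \<in> carrier G" and "U \<subseteq> E"
  shows "undecided G n X ((\<lambda>A. k <# A) ` U) = (\<lambda>A. k <# A) ` undecided G n X U"
proof -
  have "(\<lambda>A. carrier G - A) ` (\<lambda>A. k <# A) ` U = (\<lambda>A. k <# A) ` (\<lambda>A. carrier G - A) ` U"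
    using translate_complement[OF k] \<open>U \<subseteq> E\<close> by (force simp: image_image)
  moreover have "(\<lambda>A. carrier G - A) ` U \<subseteq> E"
    using E_complement \<open>U \<subseteq> E\<close> by blast
  ultimately show ?thesis
    using inj_on_image_set_diff[of "\<lambda>A. k <# A" E E "U \<union> (\<lambda>A. carrier G - A) ` U"]
      translate_bij[OF k] \<open>U \<subseteq> E\<close>
    unfolding undecided_def bij_betw_def by (simp add: image_Un)
qed

text \<open>
  Every ingredient of the construction -- distance, coboundary, almost inclusion and complementation --
  is invariant under left translation, so the translate of a sequence of choices of minimal elements at \<open>g\<close>
  is a possible sequence of choices at \<open>k g\<close>.
\<close>
lemma stage_translate:
  assumes S: "S \<subseteq> carrier G" and k: "k \<in> carrier G" and g: "g \<in> carrier G"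
    and "construction_stage G n H X S R g U"
  shows "construction_stage G n H X S R (k \<otimes> g) ((\<lambda>A. k <# A) ` U)"
  using assms(4)
proof induction
  case start
  let ?I = "initial_set G n X S R" and ?N = "near_sets G n X S R"
  let ?up = "\<lambda>g. {B \<in> ?N g. \<exists>A\<in>?I g. A \<preceq> B}"
  have sub: "?I h \<subseteq> E" "?N h \<subseteq> E" for h
    by (auto simp: initial_set_def near_sets_def)
  have I: "(\<lambda>A. k <# A) ` ?I g = ?I (k \<otimes> g)"
    using S k g sub by (intro translate_image_eqI) (auto simp: initial_set_translate_iff)
  moreover have "(\<lambda>A. k <# A) ` ?up g = ?up (k \<otimes> g)"
  proof (rule translate_image_eqI[OF k])
    fix B assume B: "B \<in> E"
    have "(\<exists>A\<in>?I (k \<otimes> g). A \<preceq> k <# B) \<longleftrightarrow> (\<exists>A\<in>?I g. A \<preceq> B)"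
      unfolding I[symmetric] using almost_incl_translate_iff[OF k _ B] sub by blast
    then show "k <# B \<in> ?up (k \<otimes> g) \<longleftrightarrow> B \<in> ?up g"
      using near_sets_translate_iff[OF S k g B] by simp
  qed (use sub in auto)
  ultimately have "(\<lambda>A. k <# A) ` (?I g \<union> ?up g) = ?I (k \<otimes> g) \<union> ?up (k \<otimes> g)"
    by (simp only: image_Un)
  then show ?case
    by (simp only: construction_stage.start)
next
  case (step U A)
  let ?\<tau> = "\<lambda>A. k <# A"
  have UE: "U \<subseteq> E" using step.hyps(1) by (rule stage_subset)
  have und: "undecided G n X U \<subseteq> E" by (auto simp: undecided_def)
  have AE: "A \<in> E" using step.hyps(2) und by blast
  note und_eq = undecided_translate[OF k UE]
  have "?\<tau> ` {B \<in> undecided G n X U. A \<preceq> B} = {B \<in> undecided G n X (?\<tau> ` U). ?\<tau> A \<preceq> B}"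
    unfolding und_eq using almost_incl_translate_iff[OF k AE] und by blast
  moreover have "construction_stage G n H X S R (k \<otimes> g)
      (?\<tau> ` U \<union> {B \<in> undecided G n X (?\<tau> ` U). ?\<tau> A \<preceq> B})"
  proof (rule construction_stage.step[OF step.IH])
    show "?\<tau> A \<in> undecided G n X (?\<tau> ` U)"
      using step.hyps(2) unfolding und_eq by blast
    show "B = ?\<tau> A" if "B \<in> undecided G n X (?\<tau> ` U)" "B \<preceq> ?\<tau> A" for B
      using that step.hyps(3) almost_incl_translate_iff[OF k _ AE] und unfolding und_eq by blast
  qed
  ultimately show ?case by (simp only: image_Un)
qed

lemma basic_vertices_L_translate:
  assumes S: "S \<subseteq> carrier G" and k: "k \<in> carrier G" and "W \<in> basic_vertices_L G n H X S R"
  shows "(\<lambda>A. k <# A) ` W \<in> basic_vertices_L G n H X S R"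
proof -
  obtain g where g: "g \<in> carrier G" and W: "construction_stage G n H X S R g W"
    and und: "undecided G n X W = {}"
    using assms(3) unfolding basic_vertices_L_def by blast
  have "construction_stage G n H X S R (k \<otimes> g) ((\<lambda>A. k <# A) ` W)"
    using S k g W by (rule stage_translate)
  moreover have "undecided G n X ((\<lambda>A. k <# A) ` W) = {}"
    using undecided_translate[OF k stage_subset[OF W]] und by simp
  ultimately show ?thesis
    using k g unfolding basic_vertices_L_def by blast
qed

definition basic_vertex_C :: "'a \<Rightarrow> 'a set set" where
  "basic_vertex_C g = {A \<in> E. g \<in> A}"

lemma basic_vertex_C_ultrafilter:
  assumes "g \<in> carrier G"
  shows "ultrafilter_on E (\<lambda>A. carrier G - A) (\<subseteq>) (basic_vertex_C g)"
  using assms E_complement unfolding ultrafilter_on_def basic_vertex_C_def by blast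

lemma basic_vertex_C_translate:
  assumes "k \<in> carrier G" "g \<in> carrier G"
  shows "(\<lambda>A. k <# A) ` basic_vertex_C g = basic_vertex_C (k \<otimes> g)"
  using assms E_translate E_subset
  by (intro translate_image_eqI) (auto simp: basic_vertex_C_def mem_l_coset_iff m_assoc[symmetric])

text \<open>
  The first stage already contains all sets that contain \<open>g\<close> and have no coboundary near \<open>g\<close>, and later
  stages only add sets.
\<close>
lemma basic_vertex_C_minus_stage_finite:
  assumes "finite_generating_set G S" "g \<in> carrier G"
    and "construction_stage G n H X S R g W"
  shows "finite (basic_vertex_C g - W)"
proof (rule finite_subset)
  show "basic_vertex_C g - W \<subseteq> near_sets G n X S R g"
    using initial_subset_stage[OF assms(3)] unfolding basic_vertex_C_def initial_set_def by blast
qed (use assms finite_near_sets in blast)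


section \<open>Comparing the two cubings\<close>

abbreviation complex_subset :: "'a set set cell set" where
  "complex_subset \<equiv> poset_complex E (\<lambda>A. carrier G - A) (\<subseteq>)"

abbreviation complex_almost :: "'a set set cell set" where
  "complex_almost \<equiv> poset_complex E (\<lambda>A. carrier G - A) (\<preceq>)"

lemma complex_almost_subset: "complex_almost \<subseteq> complex_subset"
  by (rule poset_complex_mono) (rule subset_imp_almost_incl)

lemma cubing_C_eq: "cubing_C G n X = component_containing complex_subset (basic_vertex_C ` carrier G)"
  unfolding cubing_C_def basic_vertex_C_def by (simp add: image_def Setcompr_eq_image)

text \<open>
  The path from a basic vertex of \<open>C\<close> to a vertex of \<open>L\<close> has two parts: flips from \<open>V\<^sub>g\<close> to
  \<open>W\<^sub>g\<close>, whose intermediate vertices are ultrafilters for inclusion only, and then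
  a path inside \<open>L\<close>.
\<close>
lemma cubing_L_subset_cubing_C:
  assumes S: "finite_generating_set G S"
  shows "cubing_L G n H X S R \<subseteq> cubing_C G n X"
proof
  fix c assume c: "c \<in> cubing_L G n H X S R"
  have cK: "c \<in> complex_subset"
    using c complex_almost_subset unfolding cubing_L_def component_containing_def by blast
  have mono: "edge_joined complex_almost \<le> edge_joined complex_subset"
    using complex_almost_subset unfolding edge_joined_def by blast
  have "\<exists>b\<in>basic_vertex_C ` carrier G. Vert b \<in> complex_subset \<and>
      (edge_joined complex_subset)\<^sup>*\<^sup>* b v" if v: "v \<in> set_cell c" for v
  proof -
    obtain W where W: "W \<in> basic_vertices_L G n H X S R" "Vert W \<in> complex_almost"
      and Wv: "(edge_joined complex_almost)\<^sup>*\<^sup>* W v"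
      using c v unfolding cubing_L_def component_containing_def by blast
    obtain g where g: "g \<in> carrier G" and stage: "construction_stage G n H X S R g W"
      using W unfolding basic_vertices_L_def by blast
    have "Vert W \<in> complex_subset"
      using W complex_almost_subset by blast
    then obtain m where "n_cube {V. ultrafilter_on E (\<lambda>A. carrier G - A) (\<subseteq>) V}
        (flip_adjacent (\<lambda>A. carrier G - A)) m (Vert W)"
      unfolding poset_complex_def cubed_complex_def by blast
    then have "ultrafilter_on E (\<lambda>A. carrier G - A) (\<subseteq>) W"
      using n_cube_vertices by fastforce
    then have "(edge_joined complex_subset)\<^sup>*\<^sup>* (basic_vertex_C g) W"
      using basic_vertex_C_ultrafilter[OF g] E_complement E_double_complement
        basic_vertex_C_minus_stage_finite[OF S g stage]
      by (intro ultrafilters_connected) (auto simp: antisymp_def transp_def)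
    also have "(edge_joined complex_subset)\<^sup>*\<^sup>* W v"
      using Wv rtranclp_mono[OF mono] by blast
    finally have "(edge_joined complex_subset)\<^sup>*\<^sup>* (basic_vertex_C g) v" .
    moreover have "Vert (basic_vertex_C g) \<in> complex_subset"
      using basic_vertex_C_ultrafilter[OF g]
      unfolding poset_complex_def cubed_complex_def by (blast intro: n_cube.vertex)
    ultimately show ?thesis using g by blast
  qed
  then show "c \<in> cubing_C G n X"
    using cK unfolding cubing_C_eq component_containing_def by blast
qed

lemma cubing_L_has_chart:
  assumes "c \<in> cubing_L G n H X S R"
  shows "\<exists>m \<phi>. chart m \<phi> c"
proof -
  obtain m where "n_cube {V. ultrafilter_on E (\<lambda>A. carrier G - A) (\<preceq>) V}
      (flip_adjacent (\<lambda>A. carrier G - A)) m c"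
    using assms
    unfolding cubing_L_def component_containing_def poset_complex_def cubed_complex_def by blast
  then have "\<exists>\<phi>. chart m \<phi> c"
    by (rule n_cube_has_chart) (use flip_adjacent_irrefl in blast)
  then show ?thesis by blast
qed

lemma cubing_L_invariant:
  assumes "S \<subseteq> carrier G" "g \<in> carrier G" "p \<in> realization (cubing_L G n H X S R)"
  shows "map_point (translate_vertex G g) p \<in> realization (cubing_L G n H X S R)"
proof -
  have "translate_vertex G g = (\<lambda>V. (\<lambda>A. g <# A) ` V)"
    by (simp add: translate_vertex_def fun_eq_iff)
  moreover have "map_point (\<lambda>V. (\<lambda>A. g <# A) ` V) p \<in> realization (cubing_L G n H X S R)"
    unfolding cubing_L_def
    by (rule realization_poset_component_image)
      (use assms translate_bij translate_complement E_complement basic_vertices_L_translate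
        in \<open>auto simp: cubing_L_def almost_incl_translate_iff\<close>)
  ultimately show ?thesis by simp
qed

lemma cubing_C_invariant:
  assumes "g \<in> carrier G" "p \<in> realization (cubing_C G n X)"
  shows "map_point (translate_vertex G g) p \<in> realization (cubing_C G n X)"
proof -
  have "translate_vertex G g = (\<lambda>V. (\<lambda>A. g <# A) ` V)"
    by (simp add: translate_vertex_def fun_eq_iff)
  moreover have "map_point (\<lambda>V. (\<lambda>A. g <# A) ` V) p \<in> realization (cubing_C G n X)"
    unfolding cubing_C_eq
  proof (rule realization_poset_component_image)
    show "p \<in> realization (component_containing complex_subset (basic_vertex_C ` carrier G))"
      using assms by (simp add: cubing_C_eq)
    show "A \<subseteq> B" if "A \<in> E" "B \<in> E" "g <# A \<subseteq> g <# B" for A B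
    proof -
      have "inv g <# (g <# A) \<subseteq> inv g <# (g <# B)"
        using that(3) unfolding l_coset_def by blast
      then show ?thesis
        using that E_subset assms(1) by (simp add: l_coset_cancel)
    qed
    show "(\<lambda>A. g <# A) ` b \<in> basic_vertex_C ` carrier G" if "b \<in> basic_vertex_C ` carrier G" for b
      using that assms(1) basic_vertex_C_translate by auto
  qed (use assms translate_bij translate_complement E_complement in auto)
  ultimately show ?thesis by simp
qed

end

theorem theorem3p5:
  fixes G :: "('a, 'b) monoid_scheme" and n :: nat and H X :: "nat \<Rightarrow> 'a set"
    and S :: "'a set" and R :: real
  assumes "group G"
    and "finite_generating_set G S"
    and "\<And>i. i \<in> {1..n} \<Longrightarrow> finitely_generated_subgroup G (H i)"
    and "\<And>i. i \<in> {1..n} \<Longrightarrow> nontrivial_almost_invariant G (H i) (X i)"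
    and "good_position G n H X"
    and "admissible_radius G n H X S R"
  shows "\<exists>f. cubical_embedding (cubing_L G n H X S R) (cubing_C G n X) f \<and>
             identity_on_vertices (cubing_L G n H X S R) (cubing_C G n X) f \<and>
             equivariant_map G (translate_vertex G) (translate_vertex G)
               (cubing_L G n H X S R) (cubing_C G n X) f"
proof (intro exI conjI)
  let ?L = "cubing_L G n H X S R" and ?C = "cubing_C G n X" and ?id = "\<lambda>p. p"
  interpret group G by fact
  interpret almost_invariant_family G n H X
  proof (intro almost_invariant_family.intro almost_invariant_family_axioms.intro)
    show "subgroup (H i) G" if "i \<in> {1..n}" for i
      using assms(3)[OF that] by (simp add: finitely_generated_subgroup_def)
    show "almost_invariant_over G (H i) (X i)" if "i \<in> {1..n}" for i
      using assms(4)[OF that] by (simp add: nontrivial_almost_invariant_def)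
  qed fact
  have LC: "?L \<subseteq> ?C"
    using assms(2) by (rule cubing_L_subset_cubing_C)
  show "cubical_embedding ?L ?C ?id"
    unfolding cubical_embedding_def
  proof (intro conjI ballI)
    fix c assume c: "c \<in> ?L"
    then obtain m \<phi> where "chart m \<phi> c"
      using cubing_L_has_chart by blast
    then have "isometric_onto ?id c c" by (rule identity_isometric_onto)
    then show "\<exists>d\<in>?C. isometric_onto ?id c d"
      using c LC by blast
  qed simp
  show "identity_on_vertices ?L ?C ?id"
    using LC unfolding identity_on_vertices_def by blast
  have "S \<subseteq> carrier G"
    using assms(2) unfolding finite_generating_set_def by blast
  then show "equivariant_map G (translate_vertex G) (translate_vertex G) ?L ?C ?id"
    using cubing_L_invariant cubing_C_invariant unfolding equivariant_map_def by blast
qed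

end
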